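(* Let $(E,d)$ be a complete geodesic metric space, $\mathcal{E}:E\to(-\infty,+\infty]$ a lower semi-continuous functional with $\mathcal{D}(\mathcal{E})\ne\emptyset$, and $\kappa\in\mathbb{R}$. Assume: (a) $E_0:=\mathcal{D}(\mathcal{E})$ is dense in $E$ and the restriction of $d$ to $E_0$ is such that $(E_0,d)$ is a smooth Riemannian manifold (with $d$ its Riemannian distance). (b) $\mathcal{E}$ is continuously differentiable on $E_0$. (c) $\mathcal{E}$ is $\kappa$-convex along geodesics in $E_0$. Then for every $\lambda>0$, all bounded and uniformly continuous $h^\dagger,h^\ddagger:E\to\mathbb{R}$, every viscosity subsolution $u:E\to\mathbb{R}$ to $f-\lambda H_\dagger f=h^\dagger$ and every viscosity supersolution $v:E\to\mathbb{R}$ to $f-\lambda H_\ddagger f=h^\ddagger$, $$\sup_{\pi\in E}\big(u(\pi)-v(\pi)\big)\le\sup_{\pi\in E}\big(h^\dagger(\pi)-h^\ddagger(\pi)\big).$$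
   Context: Domain: $\mathcal{D}(\mathcal{E})=\{\pi\in E:\mathcal{E}(\pi)<+\infty\}$. Geodesics: a geodesic from $\rho$ to $\pi$ is a curve $\zeta:[0,1]\to E$ with $\zeta(0)=\rho$, $\zeta(1)=\pi$ and $d(\zeta(s),\zeta(t))=|t-s|d(\rho,\pi)$ for all $s,t\in[0,1]$. $(E,d)$ is geodesic if any two points are joined by a geodesic. $\mathcal{E}$ is $\kappa$-convex on a curve $\gamma:[0,1]\to\mathcal{D}(\mathcal{E})$ if $\mathcal{E}(\gamma(t))\le(1-t)\mathcal{E}(\gamma(0))+t\mathcal{E}(\gamma(1))-\frac{\kappa}{2}t(1-t)d^2(\gamma(0),\gamma(1))$ for all $t\in[0,1]$; $\kappa$-convex along geodesics in $E_0$ means $\kappa$-convex on the geodesics contained in $E_0$. EVI gradient flow: a solution of $EVI_\kappa$ is a continuous curve $\gamma:[0,+\infty)\to E$ with $\gamma((0,+\infty))\subseteq\mathcal{D}(\mathcal{E})$ such that for all $\rho\in\mathcal{D}(\mathcal{E})$, $t\in[0,+\infty)$, $$\frac12\frac{d^+}{dt}d^2(\gamma(t),\rho)\le\mathcal{E}(\rho)-\mathcal{E}(\gamma(t))-\frac{\kappa}{2}d^2(\gamma(t),\rho),$$ where $\frac{d^+}{dt}$ is the upper right time derivative. An $EVI_\kappa$ gradient flow of $\mathcal{E}$ on $E$ is a family of continuous maps $S(t):E\to E$, $t\ge0$, such that for every $\pi\in E$: $S[\pi](0)=\pi$, $S[\pi](t+s)=S[S[\pi](t)](s)$ for $s,t\ge0$,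 and $t\mapsto S[\pi](t)$ is a solution of $EVI_\kappa$. One writes $\pi(t):=S[\pi](t)$. In the setting of the claim such a flow exists (and is unique), and it is the one used below. Tataru distance: with $\hat\kappa=\min(0,\kappa)$, $d_T(\pi,\rho)=\inf_{t\ge0}\{t+e^{\hat\kappa t}d(\pi,\rho(t))\}$ for $\pi,\rho\in E$. Hamiltonians: $H_\dagger$ is the set of all pairs $(f^\dagger,g^\dagger)$ of functions on $E$, indexed by $a,b>0$, $c\in\mathbb{R}$, $\mu,\rho\in E$ with $\mathcal{E}(\rho)<\infty$, of the form $$f^\dagger(\pi)=\tfrac12 a\,d^2(\pi,\rho)+b\,d_T(\pi,\mu)+c,$$ $$g^\dagger(\pi)=a[\mathcal{E}(\rho)-\mathcal{E}(\pi)]-a\tfrac{\kappa}{2}d^2(\pi,\rho)+b+\tfrac12a^2d^2(\pi,\rho)+ab\,d(\pi,\rho)+\tfrac12b^2.$$ $H_\ddagger$ is the set of all pairs $(f^\ddagger,g^\ddagger)$, indexed by $a,b>0$, $c\in\mathbb{R}$, $\pi,\gamma\in E$ with $\mathcal{E}(\gamma)<\infty$, of the form $$f^\ddagger(\mu)=-\tfrac12a\,d^2(\gamma,\mu)-b\,d_T(\mu,\pi)+c,$$ $$g^\ddagger(\mu)=a[\mathcal{E}(\mu)-\mathcal{E}(\gamma)]+a\tfrac{\kappa}{2}d^2(\gamma,\mu)-b+\tfrac12a^2d^2(\gamma,\mu)-ab\,d(\gamma,\mu)-\tfrac12b^2.$$ Viscosity solutions: $u$ is a (viscosity) subsolution of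 $f-\lambda H_\dagger f=h^\dagger$ if $u$ is bounded, upper semi-continuous and for all $(f,g)\in H_\dagger$ there is a sequence $(\pi_n)$ in $E$ with $\lim_n (u(\pi_n)-f(\pi_n))=\sup_\pi (u(\pi)-f(\pi))$ and $\limsup_n (u(\pi_n)-\lambda g(\pi_n)-h^\dagger(\pi_n))\le0$. $v$ is a (viscosity) supersolution of $f-\lambda H_\ddagger f=h^\ddagger$ if $v$ is bounded, lower semi-continuous and for all $(f,g)\in H_\ddagger$ there is a sequence $(\pi_n)$ in $E$ with $\lim_n (v(\pi_n)-f(\pi_n))=\inf_\pi (v(\pi)-f(\pi))$ and $\liminf_n (v(\pi_n)-\lambda g(\pi_n)-h^\ddagger(\pi_n))\ge0$. *)

theory Defs
  imports "HOL-Analysis.Analysis"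
begin

definition lsc :: "('a::topological_space \<Rightarrow> ereal) \<Rightarrow> bool" where
  "lsc f \<longleftrightarrow> (\<forall>x. f x \<le> Liminf (at x) f)"

definition usc :: "('a::topological_space \<Rightarrow> ereal) \<Rightarrow> bool" where
  "usc f \<longleftrightarrow> (\<forall>x. Limsup (at x) f \<le> f x)"

definition eff_domain :: "('a \<Rightarrow> ereal) \<Rightarrow> 'a set" where
  "eff_domain \<E> = {\<pi>. \<E> \<pi> < \<infinity>}"

definition geodesic :: "(real \<Rightarrow> 'a::metric_space) \<Rightarrow> 'a \<Rightarrow> 'a \<Rightarrow> bool" where
  "geodesic \<zeta> \<rho> \<pi> \<longleftrightarrow> \<zeta> 0 = \<rho> \<and> \<zeta> 1 = \<pi> \<and>
     (\<forall>s\<in>{0..1}. \<forall>t\<in>{0..1}. dist (\<zeta> s) (\<zeta> t) = \<bar>t - s\<bar> * dist \<rho> \<pi>)"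

definition convex_on_curve :: "real \<Rightarrow> ('a::metric_space \<Rightarrow> ereal) \<Rightarrow> (real \<Rightarrow> 'a) \<Rightarrow> bool" where
  "convex_on_curve \<kappa> \<E> \<gamma> \<longleftrightarrow>
     (\<forall>t\<in>{0..1}. \<E> (\<gamma> t) \<le> ereal (1 - t) * \<E> (\<gamma> 0) + ereal t * \<E> (\<gamma> 1)
                       - ereal (\<kappa> / 2 * t * (1 - t) * (dist (\<gamma> 0) (\<gamma> 1))\<^sup>2))"

definition convex_along_geodesics_in ::
    "'a::metric_space set \<Rightarrow> real \<Rightarrow> ('a \<Rightarrow> ereal) \<Rightarrow> bool" where
  "convex_along_geodesics_in M \<kappa> \<E> \<longleftrightarrow>
     (\<forall>\<zeta> \<rho> \<pi>. geodesic \<zeta> \<rho> \<pi> \<and> \<zeta> ` {0..1} \<subseteq> M \<longrightarrow> convex_on_curve \<kappa> \<E> \<zeta>)"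

text \<open>\<open>C_k_on k f S\<close> is meant for open \<open>S\<close>: the function is \<open>k\<close> times continuously
  differentiable on \<open>S\<close>, expressed through all directional derivatives.\<close>

primrec C_k_on :: "nat \<Rightarrow> ('b::euclidean_space \<Rightarrow> 'c::real_normed_vector) \<Rightarrow> 'b set \<Rightarrow> bool" where
  "C_k_on 0 f S \<longleftrightarrow> continuous_on S f"
| "C_k_on (Suc k) f S \<longleftrightarrow>
     (\<exists>f'. (\<forall>x\<in>S. (f has_derivative f' x) (at x)) \<and> (\<forall>v. C_k_on k (\<lambda>x. f' x v) S))"

definition smooth_on :: "('b::euclidean_space \<Rightarrow> 'c::real_normed_vector) \<Rightarrow> 'b set \<Rightarrow> bool" where
  "smooth_on f S \<longleftrightarrow> (\<forall>k. C_k_on k f S)"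

text \<open>A chart is a pair of its domain and the coordinate map; the latter is only relevant on the
  domain.\<close>

type_synonym ('a, 'b) chart = "'a set \<times> ('a \<Rightarrow> 'b)"

definition transition :: "('a, 'b) chart \<Rightarrow> ('a, 'b) chart \<Rightarrow> 'b \<Rightarrow> 'b" where
  "transition p q = snd q \<circ> inv_into (fst p) (snd p)"

definition smooth_atlas ::
    "'a::metric_space set \<Rightarrow> ('a, 'b::euclidean_space) chart set \<Rightarrow> bool" where
  "smooth_atlas M A \<longleftrightarrow>
     second_countable (top_of_set M) \<and>
     (\<Union>p\<in>A. fst p) = M \<and>
     (\<forall>(U, \<phi>)\<in>A. openin (top_of_set M) U \<and> open (\<phi> ` U) \<and>
                 homeomorphism U (\<phi> ` U) \<phi> (inv_into U \<phi>)) \<and>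
     (\<forall>p\<in>A. \<forall>q\<in>A. smooth_on (transition p q) (snd p ` (fst p \<inter> fst q)))"

text \<open>A Riemannian metric is given by its coordinate expressions: \<open>G p x v w\<close> is the inner product
  of the vectors with coordinates \<open>v\<close> and \<open>w\<close> at the point with coordinates \<open>x\<close> in the chart
  \<open>p\<close>. The last conjunct is the transformation rule of a covariant 2-tensor.\<close>

definition riemannian_metric ::
    "('a, 'b::euclidean_space) chart set \<Rightarrow> (('a, 'b) chart \<Rightarrow> 'b \<Rightarrow> 'b \<Rightarrow> 'b \<Rightarrow> real) \<Rightarrow> bool" where
  "riemannian_metric A G \<longleftrightarrow>
     (\<forall>p\<in>A. \<forall>x\<in>snd p ` fst p.
        bilinear (G p x) \<and> (\<forall>v w. G p x v w = G p x w v) \<and> (\<forall>v. v \<noteq> 0 \<longrightarrow> G p x v v > 0)) \<and>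
     (\<forall>p\<in>A. \<forall>v w. smooth_on (\<lambda>x. G p x v w) (snd p ` fst p)) \<and>
     (\<forall>p\<in>A. \<forall>q\<in>A. \<forall>x\<in>snd p ` (fst p \<inter> fst q). \<forall>v w.
        (let D = frechet_derivative (transition p q) (at x)
         in G p x v w = G q (transition p q x) (D v) (D w)))"

definition C1_curve_on ::
    "('a, 'b::euclidean_space) chart set \<Rightarrow> (real \<Rightarrow> 'a::metric_space) \<Rightarrow> real \<Rightarrow> real \<Rightarrow> bool" where
  "C1_curve_on A c a b \<longleftrightarrow> continuous_on {a..b} c \<and> c ` {a..b} \<subseteq> (\<Union>p\<in>A. fst p) \<and>
     (\<forall>(U, \<phi>)\<in>A. \<exists>c'. continuous_on {t\<in>{a..b}. c t \<in> U} c' \<and>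
        (\<forall>t\<in>{a..b}. c t \<in> U \<longrightarrow> (\<phi> \<circ> c has_vector_derivative c' t) (at t within {a..b})))"

definition piecewise_C1_curve ::
    "('a, 'b::euclidean_space) chart set \<Rightarrow> (real \<Rightarrow> 'a::metric_space) \<Rightarrow> bool" where
  "piecewise_C1_curve A c \<longleftrightarrow>
     (\<exists>n (\<tau> :: nat \<Rightarrow> real). \<tau> 0 = 0 \<and> \<tau> n = 1 \<and>
        (\<forall>i<n. \<tau> i < \<tau> (Suc i) \<and> C1_curve_on A c (\<tau> i) (\<tau> (Suc i))))"

text \<open>For a Riemannian metric the speed does not depend on the chart chosen around \<open>c t\<close>. Its value
  is only meaningful away from the endpoints and the finitely many breakpoints of a piecewise
  \<open>C\<^sup>1\<close> curve, which do not contribute to the length.\<close>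

definition curve_speed ::
    "('a, 'b::euclidean_space) chart set \<Rightarrow> (('a, 'b) chart \<Rightarrow> 'b \<Rightarrow> 'b \<Rightarrow> 'b \<Rightarrow> real)
      \<Rightarrow> (real \<Rightarrow> 'a) \<Rightarrow> real \<Rightarrow> real" where
  "curve_speed A G c t =
     (let p = (SOME p. p \<in> A \<and> c t \<in> fst p);
          v = vector_derivative (snd p \<circ> c) (at t)
      in sqrt (G p (snd p (c t)) v v))"

definition curve_length ::
    "('a, 'b::euclidean_space) chart set \<Rightarrow> (('a, 'b) chart \<Rightarrow> 'b \<Rightarrow> 'b \<Rightarrow> 'b \<Rightarrow> real)
      \<Rightarrow> (real \<Rightarrow> 'a) \<Rightarrow> real" where
  "curve_length A G c = integral {0..1} (curve_speed A G c)"

definition connecting_curves ::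
    "('a, 'b::euclidean_space) chart set \<Rightarrow> 'a::metric_space \<Rightarrow> 'a \<Rightarrow> (real \<Rightarrow> 'a) set" where
  "connecting_curves A x y = {c. piecewise_C1_curve A c \<and> c 0 = x \<and> c 1 = y}"

text \<open>\<open>M\<close> with the restricted distance is a smooth Riemannian manifold of finite dimension
  and the distance is its Riemannian distance. Being a real-valued infimum of lengths of
  connecting curves, the distance forces \<open>M\<close> to be connected. Euclidean spaces in HOL have positive
  dimension, so manifolds of dimension 0 (connected, hence a single point) are a separate case,
  in which no charts are needed.\<close>

definition riemannian_manifold ::
    "'a::metric_space set \<Rightarrow> ('a, 'b::euclidean_space) chart set
      \<Rightarrow> (('a, 'b) chart \<Rightarrow> 'b \<Rightarrow> 'b \<Rightarrow> 'b \<Rightarrow> real) \<Rightarrow> bool" where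
  "riemannian_manifold M A G \<longleftrightarrow>
     (\<exists>x. M = {x} \<and> A = {}) \<or>
     (smooth_atlas M A \<and> riemannian_metric A G \<and>
      (\<forall>x\<in>M. \<forall>y\<in>M. connecting_curves A x y \<noteq> {} \<and>
         dist x y = (INF c\<in>connecting_curves A x y. curve_length A G c)))"

definition continuously_differentiable ::
    "('a, 'b::euclidean_space) chart set \<Rightarrow> ('a \<Rightarrow> real) \<Rightarrow> bool" where
  "continuously_differentiable A f \<longleftrightarrow>
     (\<forall>(U, \<phi>)\<in>A. C_k_on 1 (f \<circ> inv_into U \<phi>) (\<phi> ` U))"

definition upper_right_deriv :: "(real \<Rightarrow> real) \<Rightarrow> real \<Rightarrow> ereal" where
  "upper_right_deriv f t = Limsup (at_right t) (\<lambda>s. ereal ((f s - f t) / (s - t)))"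

text \<open>At time 0 the curve may start outside the domain; the inequality then says that the upper
  right derivative is \<open>-\<infinity>\<close>.\<close>

definition EVI_solution :: "real \<Rightarrow> ('a::metric_space \<Rightarrow> ereal) \<Rightarrow> (real \<Rightarrow> 'a) \<Rightarrow> bool" where
  "EVI_solution \<kappa> \<E> \<gamma> \<longleftrightarrow> continuous_on {0..} \<gamma> \<and> \<gamma> ` {0<..} \<subseteq> eff_domain \<E> \<and>
     (\<forall>\<rho>\<in>eff_domain \<E>. \<forall>t\<ge>0.
        ereal (1 / 2) * upper_right_deriv (\<lambda>s. (dist (\<gamma> s) \<rho>)\<^sup>2) t
          \<le> \<E> \<rho> - \<E> (\<gamma> t) - ereal (\<kappa> / 2 * (dist (\<gamma> t) \<rho>)\<^sup>2))"

definition EVI_gradient_flow ::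
    "real \<Rightarrow> ('a::metric_space \<Rightarrow> ereal) \<Rightarrow> (real \<Rightarrow> 'a \<Rightarrow> 'a) \<Rightarrow> bool" where
  "EVI_gradient_flow \<kappa> \<E> S \<longleftrightarrow>
     (\<forall>t\<ge>0. continuous_on UNIV (S t)) \<and>
     (\<forall>\<pi>. S 0 \<pi> = \<pi> \<and>
          (\<forall>s\<ge>0. \<forall>t\<ge>0. S (t + s) \<pi> = S s (S t \<pi>)) \<and>
          EVI_solution \<kappa> \<E> (\<lambda>t. S t \<pi>))"

definition tataru_dist ::
    "real \<Rightarrow> (real \<Rightarrow> 'a \<Rightarrow> 'a) \<Rightarrow> 'a::metric_space \<Rightarrow> 'a \<Rightarrow> real" where
  "tataru_dist \<kappa> S \<pi> \<rho> = (INF t\<in>{0..}. t + exp (min 0 \<kappa> * t) * dist \<pi> (S t \<rho>))"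

text \<open>Where \<open>\<E>\<close> is infinite, the second components take the value \<open>-\<infinity>\<close> in \<open>H_dagger\<close> and
  \<open>\<infinity>\<close> in \<open>H_ddagger\<close>.\<close>

definition H_dagger ::
    "real \<Rightarrow> ('a::metric_space \<Rightarrow> ereal) \<Rightarrow> (real \<Rightarrow> 'a \<Rightarrow> 'a) \<Rightarrow> (('a \<Rightarrow> real) \<times> ('a \<Rightarrow> ereal)) set" where
  "H_dagger \<kappa> \<E> S =
     {(\<lambda>\<pi>. 1 / 2 * a * (dist \<pi> \<rho>)\<^sup>2 + b * tataru_dist \<kappa> S \<pi> \<mu> + c,
       \<lambda>\<pi>. ereal a * (\<E> \<rho> - \<E> \<pi>)
           + ereal (- a * (\<kappa> / 2) * (dist \<pi> \<rho>)\<^sup>2 + b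
                    + 1 / 2 * a\<^sup>2 * (dist \<pi> \<rho>)\<^sup>2 + a * b * dist \<pi> \<rho> + 1 / 2 * b\<^sup>2))
      | a b c \<mu> \<rho>. a > 0 \<and> b > 0 \<and> \<rho> \<in> eff_domain \<E>}"

definition H_ddagger ::
    "real \<Rightarrow> ('a::metric_space \<Rightarrow> ereal) \<Rightarrow> (real \<Rightarrow> 'a \<Rightarrow> 'a) \<Rightarrow> (('a \<Rightarrow> real) \<times> ('a \<Rightarrow> ereal)) set" where
  "H_ddagger \<kappa> \<E> S =
     {(\<lambda>\<mu>. - (1 / 2) * a * (dist \<gamma> \<mu>)\<^sup>2 - b * tataru_dist \<kappa> S \<mu> \<pi> + c,
       \<lambda>\<mu>. ereal a * (\<E> \<mu> - \<E> \<gamma>)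
           + ereal (a * (\<kappa> / 2) * (dist \<gamma> \<mu>)\<^sup>2 - b
                    + 1 / 2 * a\<^sup>2 * (dist \<gamma> \<mu>)\<^sup>2 - a * b * dist \<gamma> \<mu> - 1 / 2 * b\<^sup>2))
      | a b c \<pi> \<gamma>. a > 0 \<and> b > 0 \<and> \<gamma> \<in> eff_domain \<E>}"

definition viscosity_subsolution ::
    "(('a::metric_space \<Rightarrow> real) \<times> ('a \<Rightarrow> ereal)) set \<Rightarrow> real \<Rightarrow> ('a \<Rightarrow> real) \<Rightarrow> ('a \<Rightarrow> real) \<Rightarrow> bool" where
  "viscosity_subsolution H l h u \<longleftrightarrow>
     bounded (range u) \<and> usc (\<lambda>\<pi>. ereal (u \<pi>)) \<and>
     (\<forall>(f, g)\<in>H. \<exists>x :: nat \<Rightarrow> 'a.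
        (\<lambda>n. ereal (u (x n) - f (x n))) \<longlonglongrightarrow> (SUP \<pi>. ereal (u \<pi> - f \<pi>)) \<and>
        limsup (\<lambda>n. ereal (u (x n)) - ereal l * g (x n) - ereal (h (x n))) \<le> 0)"

definition viscosity_supersolution ::
    "(('a::metric_space \<Rightarrow> real) \<times> ('a \<Rightarrow> ereal)) set \<Rightarrow> real \<Rightarrow> ('a \<Rightarrow> real) \<Rightarrow> ('a \<Rightarrow> real) \<Rightarrow> bool" where
  "viscosity_supersolution H l h v \<longleftrightarrow>
     bounded (range v) \<and> lsc (\<lambda>\<pi>. ereal (v \<pi>)) \<and>
     (\<forall>(f, g)\<in>H. \<exists>x :: nat \<Rightarrow> 'a.
        (\<lambda>n. ereal (v (x n) - f (x n))) \<longlonglongrightarrow> (INF \<pi>. ereal (v \<pi> - f \<pi>)) \<and>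
        liminf (\<lambda>n. ereal (v (x n)) - ereal l * g (x n) - ereal (h (x n))) \<ge> 0)"

end

theory Submission
  imports Defs
begin

text \<open>The proof doubles the variables twice. For a subsolution \<open>u\<close> and a supersolution \<open>v\<close> one
  maximizes

  \<open>u(\<pi>) - v(\<mu>) - a/2 (d\<^sup>2(\<pi>, \<rho>) + d\<^sup>2(\<rho>, \<gamma>) + d\<^sup>2(\<gamma>, \<mu>)) - b (max 0 \<E>(\<rho>) + max 0 \<E>(\<gamma>))\<close>

  over all \<open>\<pi>, \<mu>\<close> and all \<open>\<rho>, \<gamma>\<close> of finite energy. The test functions at \<open>\<pi>\<close> and \<open>\<mu>\<close> are then
  centred at \<open>\<rho>\<close> and \<open>\<gamma>\<close>, which have finite energy because of the penalty, and the difference of the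
  two viscosity inequalities contains

  \<open>a [\<E>(\<rho>) - \<E>(\<pi>)] + a [\<E>(\<gamma>) - \<E>(\<mu>)] + a\<^sup>2/2 (d\<^sup>2(\<pi>, \<rho>) - d\<^sup>2(\<gamma>, \<mu>))\<close>

  besides terms that vanish when first \<open>b \<rightarrow> 0\<close> and then \<open>a \<rightarrow> \<infinity>\<close>. Two first order conditions at the
  auxiliary points control this expression.

  Moving \<open>\<rho>\<close> along the gradient flow, EVI at time 0 bounds the change of both squared distances and
  yields \<open>a [\<E>(\<rho>) - \<E>(\<pi>)] \<le> a [\<E>(\<gamma>) - \<E>(\<rho>)]\<close> up to small terms; the same for \<open>\<gamma>\<close> gives
  \<open>a [\<E>(\<gamma>) - \<E>(\<mu>)] \<le> a [\<E>(\<rho>) - \<E>(\<gamma>)]\<close>, and in the sum the energies cancel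
  (\<open>flow_stationarity\<close>). Moving \<open>\<rho>\<close> along a geodesic towards \<open>\<pi>\<close> gives
  \<open>d(\<pi>, \<rho>) \<le> d(\<rho>, \<gamma>)\<close>, and moving \<open>\<gamma>\<close> towards \<open>\<rho>\<close> gives \<open>d(\<rho>, \<gamma>) \<le> d(\<gamma>, \<mu>)\<close>, again up to
  errors that vanish with \<open>b\<close> (\<open>geodesic_stationarity\<close>); the energy along these geodesics is controlled by
  its \<open>\<kappa>\<close>-convexity, which is itself read off from EVI at time 0 (\<open>geodesic_convex\<close>). The resulting
  estimate is \<open>hamiltonian_gap\<close>.

  Without compactness the maximum is attained only after a perturbation, provided by Ekeland's
  variational principle for the Tataru distance (\<open>ekeland_quasimetric\<close>, \<open>penalized_maximizer\<close>). This
  distance is the right one for three reasons: it occurs in the test functions, it is dominated by the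
  metric, and a point moves with speed at most one along the flow, so that the perturbation costs
  only \<open>b\<close> in each first order condition. Its triangle inequality and completeness rest on the
  contraction property of the flow (\<open>contraction\<close>).\<close>

section \<open>Upper right Dini derivatives\<close>

text \<open>The upper right Dini derivative of \<open>g\<close> at \<open>t\<close> is at most \<open>c\<close>. The \<open>\<epsilon>\<close>-form keeps all calculations
  real, although the derivative may be \<open>-\<infinity>\<close>.\<close>

definition dini_le :: "(real \<Rightarrow> real) \<Rightarrow> real \<Rightarrow> real \<Rightarrow> bool" where
  "dini_le g t c \<longleftrightarrow> (\<forall>\<epsilon>>0. \<forall>\<^sub>F s in at_right t. g s - g t \<le> (c + \<epsilon>) * (s - t))"

lemma dini_le_mono: "dini_le g t c \<Longrightarrow> c \<le> c' \<Longrightarrow> dini_le g t c'"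
  unfolding dini_le_def
proof (intro allI impI)
  fix \<epsilon> :: real
  assume g: "\<forall>\<epsilon>>0. \<forall>\<^sub>F s in at_right t. g s - g t \<le> (c + \<epsilon>) * (s - t)" and c: "c \<le> c'" and "\<epsilon> > 0"
  then have "\<forall>\<^sub>F s in at_right t. g s - g t \<le> (c + \<epsilon>) * (s - t)" by blast
  moreover have "\<forall>\<^sub>F s in at_right t. s > t" by (simp add: eventually_at_filter)
  ultimately show "\<forall>\<^sub>F s in at_right t. g s - g t \<le> (c' + \<epsilon>) * (s - t)"
  proof eventually_elim
    case (elim s)
    have "(c + \<epsilon>) * (s - t) \<le> (c' + \<epsilon>) * (s - t)"
      using c elim(2) by (intro mult_right_mono) auto
    with elim(1) show ?case by linarith
  qed
qed

lemma dini_le_linear_combination: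
  assumes f: "dini_le f t c" and g: "dini_le g t d" and p: "p \<ge> 0" and q: "q \<ge> 0"
  shows "dini_le (\<lambda>s. p * f s + q * g s) t (p * c + q * d)"
  unfolding dini_le_def
proof (intro allI impI)
  fix \<epsilon> :: real assume e: "\<epsilon> > 0"
  define e1 where "e1 = \<epsilon> / (p + q + 1)"
  have e1: "e1 > 0" using e p q by (simp add: e1_def)
  have e2: "(p + q) * e1 \<le> \<epsilon>" using e p q by (simp add: e1_def field_simps)
  have "\<forall>\<^sub>F s in at_right t. f s - f t \<le> (c + e1) * (s - t)"
    and "\<forall>\<^sub>F s in at_right t. g s - g t \<le> (d + e1) * (s - t)"
    using f g e1 by (auto simp: dini_le_def)
  moreover have "\<forall>\<^sub>F s in at_right t. s > t" by (simp add: eventually_at_filter)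
  ultimately show "\<forall>\<^sub>F s in at_right t. p * f s + q * g s - (p * f t + q * g t)
      \<le> (p * c + q * d + \<epsilon>) * (s - t)"
  proof eventually_elim
    case (elim s)
    have "p * (f s - f t) + q * (g s - g t) \<le> p * ((c + e1) * (s - t)) + q * ((d + e1) * (s - t))"
      using elim p q by (intro add_mono mult_left_mono) auto
    also have "\<dots> = (p * c + q * d + (p + q) * e1) * (s - t)" by (simp add: algebra_simps)
    also have "\<dots> \<le> (p * c + q * d + \<epsilon>) * (s - t)"
      using e2 elim by (intro mult_right_mono) auto
    finally show ?case by (simp add: algebra_simps)
  qed
qed

text \<open>First order condition at a one-sided minimum that is perturbed with slope \<open>b\<close>: this is how EVI is
  used at maximum points.\<close>

lemma dini_le_of_min:
  assumes g: "dini_le g t c" and min: "\<And>s. s > t \<Longrightarrow> g t - b * (s - t) \<le> g s"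
  shows "- b \<le> c"
proof (rule field_le_epsilon)
  fix \<epsilon> :: real assume "\<epsilon> > 0"
  then have "\<forall>\<^sub>F s in at_right t. g s - g t \<le> (c + \<epsilon>) * (s - t)"
    using g by (simp add: dini_le_def)
  moreover have "\<forall>\<^sub>F s in at_right t. s > t" by (simp add: eventually_at_filter)
  ultimately have "\<forall>\<^sub>F s in at_right t. - b \<le> c + \<epsilon>"
  proof eventually_elim
    case (elim s)
    have "- b * (s - t) \<le> (c + \<epsilon>) * (s - t)" using elim(1) min[OF elim(2)] by simp
    moreover have "0 < s - t" using elim(2) by simp
    ultimately show ?case by (rule mult_right_le_imp_le)
  qed
  then show "- b \<le> c + \<epsilon>" by (simp add: eventually_const)
qed

text \<open>The bound \<open>g t - g a \<le> (c + \<epsilon>) (t - a)\<close> holds up to a last time, and the Dini derivative there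
  would push it further if this time were smaller than \<open>b\<close>.\<close>

lemma dini_le_mean_value:
  fixes a b :: real
  assumes ab: "a \<le> b" and cont: "continuous_on {a..b} g"
    and dini: "\<And>t. a \<le> t \<Longrightarrow> t < b \<Longrightarrow> dini_le g t c"
  shows "g b - g a \<le> c * (b - a)"
proof -
  have *: "g b - g a \<le> (c + \<epsilon>) * (b - a)" if e: "\<epsilon> > 0" for \<epsilon>
  proof -
    define Z where "Z = {t \<in> {a..b}. g t - g a - (c + \<epsilon>) * (t - a) \<le> 0}"
    have "compact Z"
    proof -
      have "Z = {a..b} \<inter> (\<lambda>t. g t - g a - (c + \<epsilon>) * (t - a)) -` {..0}"
        by (auto simp: Z_def)
      then have "closed Z"
        by (simp only:) (intro continuous_closed_preimage continuous_intros cont)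
      moreover have "Z \<subseteq> {a..b}" by (auto simp: Z_def)
      ultimately show ?thesis by (metis compact_Icc compact_Int_closed inf.absorb2)
    qed
    moreover have "Z \<noteq> {}" using ab by (auto simp: Z_def intro!: exI[of _ a])
    ultimately obtain r where r: "r \<in> Z" "\<And>t. t \<in> Z \<Longrightarrow> t \<le> r"
      using compact_attains_sup by metis
    have "r = b"
    proof (rule ccontr)
      assume "r \<noteq> b"
      then have rb: "a \<le> r" "r < b" using r(1) by (auto simp: Z_def)
      have "\<forall>\<^sub>F s in at_right r. g s - g r \<le> (c + \<epsilon>) * (s - r)"
        using dini[OF rb] e by (simp add: dini_le_def)
      moreover have "\<forall>\<^sub>F s in at_right r. s > r \<and> s < b"
        using rb by (simp add: eventually_conj eventually_at_right_less eventually_at_right[OF rb(2)])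
          (metis rb(2))
      ultimately have "\<forall>\<^sub>F s in at_right r. False"
      proof eventually_elim
        case (elim s)
        have "g s - g a - (c + \<epsilon>) * (s - a) \<le> 0"
          using elim(1) r(1) by (simp add: Z_def algebra_simps)
        then have "s \<in> Z" using elim rb by (auto simp: Z_def)
        then show False using r(2) elim by fastforce
      qed
      then show False by simp
    qed
    with r(1) show ?thesis by (simp add: Z_def)
  qed
  show ?thesis
  proof (cases "a = b")
    case True then show ?thesis by simp
  next
    case False
    show ?thesis
    proof (rule field_le_epsilon)
      fix e :: real assume "e > 0"
      then have "g b - g a \<le> (c + e / (b - a)) * (b - a)" using False ab by (intro *) simp
      also have "\<dots> = c * (b - a) + e" using False by (simp add: field_simps)
      finally show "g b - g a \<le> c * (b - a) + e" .
    qed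
  qed
qed

lemma dini_le_gronwall:
  fixes a b :: real
  assumes ab: "a \<le> b" and cont: "continuous_on {a..b} g"
    and dini: "\<And>t. a \<le> t \<Longrightarrow> t < b \<Longrightarrow> dini_le g t (- k * g t)"
  shows "exp (k * b) * g b \<le> exp (k * a) * g a"
proof -
  have "dini_le (\<lambda>s. exp (k * s) * g s) t 0" if t: "a \<le> t" "t < b" for t
    unfolding dini_le_def
  proof (intro allI impI)
    fix \<epsilon> :: real assume e: "\<epsilon> > 0"
    let ?E = "exp (k * t)"
    let ?D = "\<lambda>s. (exp (k * s) - ?E) / (s - t)"
    have D: "(?D \<longlongrightarrow> k * ?E) (at_right t)"
    proof -
      have "((\<lambda>s. exp (k * s)) has_real_derivative k * ?E) (at t)"
        by (auto intro!: derivative_eq_intros)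
      then show ?thesis unfolding has_field_derivative_iff
        by (rule filterlim_mono) (auto simp: at_within_le_at)
    qed
    define e1 where "e1 = \<epsilon> / (4 * ?E)"
    have e1: "e1 > 0" using e by (simp add: e1_def)
    have lim: "((\<lambda>s. exp (k * s) * (- k * g t + e1) + ?D s * g t) \<longlongrightarrow>
        ?E * (- k * g t + e1) + (k * ?E) * g t) (at_right t)"
      by (intro tendsto_intros D)
    have "?E * (- k * g t + e1) + (k * ?E) * g t < 0 + \<epsilon>"
      using e by (simp add: e1_def field_simps)
    from order_tendstoD(2)[OF lim this]
    have "\<forall>\<^sub>F s in at_right t. exp (k * s) * (- k * g t + e1) + ?D s * g t < 0 + \<epsilon>" .
    moreover have "\<forall>\<^sub>F s in at_right t. g s - g t \<le> (- k * g t + e1) * (s - t)"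
      using dini[OF t] e1 by (simp add: dini_le_def)
    moreover have "\<forall>\<^sub>F s in at_right t. s > t" by (simp add: eventually_at_filter)
    ultimately show "\<forall>\<^sub>F s in at_right t. exp (k * s) * g s - ?E * g t \<le> (0 + \<epsilon>) * (s - t)"
    proof eventually_elim
      case (elim s)
      have "exp (k * s) * g s - ?E * g t = exp (k * s) * (g s - g t) + (?D s * g t) * (s - t)"
        using elim(3) by (simp add: field_simps)
      also have "\<dots> \<le> exp (k * s) * ((- k * g t + e1) * (s - t)) + (?D s * g t) * (s - t)"
        using elim(2) by (intro add_right_mono mult_left_mono) auto
      also have "\<dots> = (exp (k * s) * (- k * g t + e1) + ?D s * g t) * (s - t)"
        by (simp add: algebra_simps)
      also have "\<dots> \<le> (0 + \<epsilon>) * (s - t)" using elim by (intro mult_right_mono) auto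
      finally show ?case .
    qed
  qed
  then have "exp (k * b) * g b - exp (k * a) * g a \<le> 0 * (b - a)"
    by (intro dini_le_mean_value ab continuous_intros cont) auto
  then show ?thesis by simp
qed

lemma dini_le_of_upper_right_deriv:
  assumes "upper_right_deriv g t \<le> ereal c"
  shows "dini_le g t c"
  unfolding dini_le_def
proof (intro allI impI)
  fix \<epsilon> :: real assume "\<epsilon> > 0"
  then have "Limsup (at_right t) (\<lambda>s. ereal ((g s - g t) / (s - t))) < ereal (c + \<epsilon>)"
    using assms unfolding upper_right_deriv_def by (simp add: le_less_trans)
  from Limsup_lessD[OF this]
  have "\<forall>\<^sub>F s in at_right t. (g s - g t) / (s - t) < c + \<epsilon>" by simp
  moreover have "\<forall>\<^sub>F s in at_right t. s > t" by (simp add: eventually_at_filter)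
  ultimately show "\<forall>\<^sub>F s in at_right t. g s - g t \<le> (c + \<epsilon>) * (s - t)"
    by eventually_elim (simp add: pos_divide_less_eq)
qed

section \<open>Semicontinuity and a variational principle\<close>

text \<open>The limit inferior in the definition of lower semicontinuity leaves out the point itself, so the
  hypothesis on \<open>f x\<close> also serves to include it.\<close>

lemma lsc_eventually_less:
  assumes "lsc f" "c < f x" shows "\<forall>\<^sub>F y in nhds x. c < f y"
proof -
  have "c < Liminf (at x) f" using assms by (auto simp: lsc_def less_le_trans)
  from less_LiminfD[OF this] show ?thesis
    using assms(2) by (auto simp: eventually_at_filter elim: eventually_mono)
qed

lemma lsc_uminus_usc: "usc f \<Longrightarrow> lsc (\<lambda>x. - f x)"
  by (simp add: usc_def lsc_def ereal_Liminf_uminus)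

lemma lsc_closed_sublevel:
  fixes f :: "'a::topological_space \<Rightarrow> ereal"
  assumes "lsc f" shows "closed {x. f x \<le> c}"
proof -
  have "open {x. c < f x}"
  proof (rule open_subopen[THEN iffD2], rule ballI)
    fix x assume "x \<in> {x. c < f x}"
    then have "\<forall>\<^sub>F y in nhds x. c < f y"
      using lsc_eventually_less[OF assms, of c x] by simp
    then show "\<exists>T. open T \<and> x \<in> T \<and> T \<subseteq> {x. c < f x}"
      unfolding eventually_nhds by blast
  qed
  moreover have "{x. f x \<le> c} = - {x. c < f x}" by auto
  ultimately show ?thesis by (simp add: closed_def)
qed

text \<open>The usual proof of Ekeland's principle survives for an asymmetric \<open>q\<close>: the relation \<open>R\<close> below only
  needs the triangle inequality in this order. A sequence that nearly maximizes \<open>\<Phi>\<close> on the shrinking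
  sets \<open>R (X n)\<close> has small \<open>q\<close>-steps from each member to its predecessor, so completeness is needed only for
  such sequences. Upper semicontinuity is phrased through superlevel sets within \<open>D\<close>, because \<open>D\<close> itself
  is not closed when it is the finiteness domain of a penalty.\<close>

lemma ekeland_quasimetric:
  fixes \<Phi> :: "'x::topological_space \<Rightarrow> real" and q :: "'x \<Rightarrow> 'x \<Rightarrow> real"
  assumes q_nonneg: "\<And>x y. q x y \<ge> 0" and q_refl: "\<And>x. q x x = 0"
    and q_triangle: "\<And>x y z. q x z \<le> q x y + q y z"
    and q_cont: "\<And>y. continuous_on UNIV (\<lambda>x. q x y)"
    and q_complete: "\<And>X :: nat \<Rightarrow> 'x. (\<And>n. q (X (Suc n)) (X n) \<le> (1/2) ^ n) \<Longrightarrow> \<exists>y. X \<longlonglongrightarrow> y"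
    and upper: "\<And>X y c. X \<longlonglongrightarrow> y \<Longrightarrow> (\<And>n::nat. X n \<in> D \<and> c \<le> \<Phi> (X n)) \<Longrightarrow> y \<in> D \<and> c \<le> \<Phi> y"
    and bdd: "bdd_above (\<Phi> ` D)" and x0: "x0 \<in> D" and b: "b > 0"
  obtains y where "y \<in> D" "\<Phi> x0 \<le> \<Phi> y" "\<And>z. z \<in> D \<Longrightarrow> \<Phi> z \<le> \<Phi> y + b * q z y"
proof -
  \<comment> \<open>\<open>R x\<close> consists of the points that improve on \<open>x\<close> by at least the perturbation.\<close>
  define R where "R x = {z \<in> D. \<Phi> x + b * q z x \<le> \<Phi> z}" for x
  have R_refl: "x \<in> R x" if "x \<in> D" for x using that by (simp add: R_def q_refl)
  have R_trans: "z \<in> R x" if "y \<in> R x" "z \<in> R y" for x y z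
  proof -
    have "b * q z x \<le> b * q z y + b * q y x"
      using mult_left_mono[OF q_triangle, of b z x y] b by (simp add: algebra_simps)
    then show ?thesis using that by (auto simp: R_def)
  qed
  have "\<exists>X. \<forall>n. (X n \<in> D \<and> (n = 0 \<longrightarrow> X n = x0)) \<and>
      (X (Suc n) \<in> R (X n) \<and> (\<forall>z\<in>R (X n). \<Phi> z \<le> \<Phi> (X (Suc n)) + b * (1/2) ^ Suc n))"
  proof (rule dependent_nat_choice)
    show "\<exists>x. x \<in> D \<and> (0 = (0::nat) \<longrightarrow> x = x0)" using x0 by blast
  next
    fix x and n :: nat assume x: "x \<in> D \<and> (n = 0 \<longrightarrow> x = x0)"
    have ne: "\<Phi> ` R x \<noteq> {}" using R_refl x by blast
    have bd: "bdd_above (\<Phi> ` R x)" by (rule bdd_above_mono[OF bdd]) (auto simp: R_def)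
    have "\<exists>s\<in>\<Phi> ` R x. Sup (\<Phi> ` R x) - b * (1/2) ^ Suc n < s"
      using b by (intro less_cSupD ne) simp
    then obtain z where z: "z \<in> R x" "Sup (\<Phi> ` R x) - b * (1/2) ^ Suc n < \<Phi> z" by blast
    have "\<Phi> w \<le> \<Phi> z + b * (1/2) ^ Suc n" if "w \<in> R x" for w
      using cSup_upper[OF _ bd, of "\<Phi> w"] that z(2) by fastforce
    with z(1) show "\<exists>y. (y \<in> D \<and> (Suc n = 0 \<longrightarrow> y = x0)) \<and> y \<in> R x \<and>
        (\<forall>z\<in>R x. \<Phi> z \<le> \<Phi> y + b * (1/2) ^ Suc n)"
      by (auto simp: R_def)
  qed
  then obtain X where X: "\<And>n. X n \<in> D" "X 0 = x0" "\<And>n. X (Suc n) \<in> R (X n)"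
      "\<And>n z. z \<in> R (X n) \<Longrightarrow> \<Phi> z \<le> \<Phi> (X (Suc n)) + b * (1/2) ^ Suc n" by blast
  have later: "X m \<in> R (X n)" if "n \<le> m" for m n
    using that by (induction rule: dec_induct) (use R_refl X(1,3) R_trans in blast)+
  have "\<exists>y. X' \<longlonglongrightarrow> y" if X': "X' = (\<lambda>n. X (Suc n))" for X'
  proof (rule q_complete)
    fix n
    have "X (Suc (Suc n)) \<in> R (X (Suc n))" using X by blast
    moreover have "\<Phi> (X (Suc (Suc n))) \<le> \<Phi> (X (Suc n)) + b * (1/2) ^ Suc n"
      by (intro X(4) later) simp
    ultimately have "b * q (X' (Suc n)) (X' n) \<le> b * (1/2) ^ Suc n" by (simp add: R_def X')
    then have "q (X' (Suc n)) (X' n) \<le> (1/2) ^ Suc n" using b by (simp add: mult_le_cancel_left)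
    then show "q (X' (Suc n)) (X' n) \<le> (1/2) ^ n"
      by (rule order_trans) (simp add: power_decreasing)
  qed
  then obtain y where "(\<lambda>n. X (Suc n)) \<longlonglongrightarrow> y" by blast
  then have y: "X \<longlonglongrightarrow> y" by (simp add: filterlim_sequentially_Suc)
  have lower: "y \<in> D \<and> \<Phi> (X k) \<le> \<Phi> y" for k
  proof (rule upper)
    show "(\<lambda>n. X (n + k)) \<longlonglongrightarrow> y" using y by (rule LIMSEQ_ignore_initial_segment)
    fix n
    have "X (n + k) \<in> R (X k)" by (rule later) simp
    moreover have "0 \<le> b * q (X (n + k)) (X k)" using b q_nonneg by simp
    ultimately show "X (n + k) \<in> D \<and> \<Phi> (X k) \<le> \<Phi> (X (n + k))" by (auto simp: R_def)
  qed
  have yR: "y \<in> R (X n)" for n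
  proof -
    have "(\<lambda>k. q (X k) (X n)) \<longlonglongrightarrow> q y (X n)"
      using continuous_on_tendsto_compose[OF q_cont y] by simp
    then have "(\<lambda>k. \<Phi> (X n) + b * q (X k) (X n)) \<longlonglongrightarrow> \<Phi> (X n) + b * q y (X n)"
      by (intro tendsto_intros)
    moreover have "\<forall>\<^sub>F k in sequentially. \<Phi> (X n) + b * q (X k) (X n) \<le> \<Phi> y"
      using eventually_ge_at_top[of n]
    proof eventually_elim
      case (elim k)
      then have "X k \<in> R (X n)" by (rule later)
      then show ?case using lower[of k] by (auto simp: R_def)
    qed
    ultimately have "\<Phi> (X n) + b * q y (X n) \<le> \<Phi> y" by (rule tendsto_upperbound) simp
    then show ?thesis using lower by (simp add: R_def)
  qed
  show ?thesis
  proof (rule that)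
    show "y \<in> D" "\<Phi> x0 \<le> \<Phi> y" using lower[of 0] X(2) by auto
    fix z assume z: "z \<in> D"
    show "\<Phi> z \<le> \<Phi> y + b * q z y"
    proof (rule ccontr)
      assume neg: "\<not> ?thesis"
      then have "z \<in> R y" using z by (simp add: R_def)
      then have zR: "z \<in> R (X n)" for n using yR R_trans by blast
      have "\<Phi> z \<le> \<Phi> y + b * (1/2) ^ Suc n" for n
        using X(4)[OF zR, of n] lower[of "Suc n"] by linarith
      moreover have "(\<lambda>n. \<Phi> y + b * (1/2) ^ Suc n) \<longlonglongrightarrow> \<Phi> y + b * 0"
        by (intro tendsto_intros LIMSEQ_Suc LIMSEQ_realpow_zero) auto
      ultimately have "\<Phi> z \<le> \<Phi> y" using LIMSEQ_le_const[of _ "\<Phi> y" "\<Phi> z"] by auto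
      moreover have "0 \<le> b * q z y" using b q_nonneg by simp
      ultimately show False using neg by simp
    qed
  qed
qed

section \<open>EVI gradient flows\<close>

locale evi_flow =
  fixes \<E> :: "'a::complete_space \<Rightarrow> ereal" and \<kappa> :: real and S :: "real \<Rightarrow> 'a \<Rightarrow> 'a"
  assumes not_minfty: "\<E> x \<noteq> -\<infinity>" and lsc: "lsc \<E>" and dom_ne: "eff_domain \<E> \<noteq> {}"
    and flow: "EVI_gradient_flow \<kappa> \<E> S"
begin

abbreviation D where "D \<equiv> eff_domain \<E>"

text \<open>Meaningful on the domain only; points of infinite energy get the value 0.\<close>

definition e :: "'a \<Rightarrow> real" where "e x = real_of_ereal (\<E> x)"

lemma D_iff: "x \<in> D \<longleftrightarrow> \<E> x \<noteq> \<infinity>"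
  by (simp add: eff_domain_def)

lemma energy_eq: "x \<in> D \<Longrightarrow> \<E> x = ereal (e x)"
  using not_minfty[of x] by (cases "\<E> x") (simp_all add: e_def D_iff)

lemma D_I: "\<E> x \<le> ereal c \<Longrightarrow> x \<in> D"
  by (auto simp: eff_domain_def)

lemma S_0 [simp]: "S 0 x = x"
  using flow by (simp add: EVI_gradient_flow_def)

lemma S_add: "s \<ge> 0 \<Longrightarrow> t \<ge> 0 \<Longrightarrow> S (t + s) x = S s (S t x)"
  using flow by (simp add: EVI_gradient_flow_def)

lemma S_continuous: "t \<ge> 0 \<Longrightarrow> continuous_on UNIV (S t)"
  using flow by (simp add: EVI_gradient_flow_def)

lemma orbit_continuous: "continuous_on {0..} (\<lambda>t. S t x)"
  using flow by (simp add: EVI_gradient_flow_def EVI_solution_def)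

lemma orbit_in_D: "t > 0 \<Longrightarrow> S t x \<in> D"
  using flow by (auto simp: EVI_gradient_flow_def EVI_solution_def)

lemma orbit_tendsto:
  assumes "t \<ge> 0" shows "((\<lambda>s. S s x) \<longlongrightarrow> S t x) (at_right t)"
proof -
  have "((\<lambda>s. S s x) \<longlongrightarrow> S t x) (at t within {0..})"
    using orbit_continuous assms by (auto simp: continuous_on_def)
  then show ?thesis by (rule tendsto_within_subset) (use assms in auto)
qed

text \<open>EVI with a lower bound \<open>r\<close> in place of the energy of the moving point. In this form it also covers
  starting points of infinite energy, where \<open>r\<close> is arbitrary.\<close>

lemma evi:
  assumes \<rho>: "\<rho> \<in> D" and t: "t \<ge> 0" and r: "ereal r \<le> \<E> (S t x)"
  shows "dini_le (\<lambda>s. (dist (S s x) \<rho>)\<^sup>2) t (2 * (e \<rho> - r) - \<kappa> * (dist (S t x) \<rho>)\<^sup>2)"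
proof (rule dini_le_of_upper_right_deriv)
  let ?U = "upper_right_deriv (\<lambda>s. (dist (S s x) \<rho>)\<^sup>2) t"
  let ?d = "(dist (S t x) \<rho>)\<^sup>2"
  have "ereal (1 / 2) * ?U \<le> \<E> \<rho> - \<E> (S t x) - ereal (\<kappa> / 2 * ?d)"
    using flow \<rho> t by (auto simp: EVI_gradient_flow_def EVI_solution_def)
  also have "\<dots> \<le> ereal (e \<rho>) - ereal r - ereal (\<kappa> / 2 * ?d)"
    using r energy_eq[OF \<rho>] by (intro ereal_minus_mono) auto
  finally show "?U \<le> ereal (2 * (e \<rho> - r) - \<kappa> * ?d)"
    by (cases ?U) (auto simp: field_simps)
qed

lemma evi_D:
  assumes "\<rho> \<in> D" "t \<ge> 0" "S t x \<in> D"
  shows "dini_le (\<lambda>s. (dist (S s x) \<rho>)\<^sup>2) t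
    (2 * (e \<rho> - e (S t x)) - \<kappa> * (dist (S t x) \<rho>)\<^sup>2)"
  using assms evi[OF assms(1,2)] energy_eq[OF assms(3)] by simp

text \<open>If the energy exceeded its initial value at time \<open>t\<close>, consider the last time \<open>r\<close> before \<open>t\<close> at which it
  does not. From then on the energy is at least that of the point at time \<open>r\<close>, so EVI tested with this point
  and Gronwall's inequality show that the orbit stays there.\<close>

lemma energy_decreasing:
  assumes "0 \<le> s" "s \<le> t" shows "\<E> (S t x) \<le> \<E> (S s x)"
proof (rule ccontr)
  assume neg: "\<not> ?thesis"
  define Z where "Z = {r \<in> {s..t}. \<E> (S r x) \<le> \<E> (S s x)}"
  have cont: "continuous_on {s..t} (\<lambda>r. S r x)"
    by (rule continuous_on_subset[OF orbit_continuous]) (use assms in auto)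
  have "Z = {s..t} \<inter> (\<lambda>r. S r x) -` {y. \<E> y \<le> \<E> (S s x)}" by (auto simp: Z_def)
  then have "closed Z" using continuous_closed_preimage[OF cont _ lsc_closed_sublevel[OF lsc]] by simp
  moreover have "Z \<subseteq> {s..t}" by (auto simp: Z_def)
  ultimately have "compact Z" by (metis compact_Icc compact_Int_closed inf.absorb2)
  moreover have "Z \<noteq> {}" using assms by (auto simp: Z_def)
  ultimately obtain r where r: "r \<in> Z" "\<And>q. q \<in> Z \<Longrightarrow> q \<le> r"
    using compact_attains_sup by metis
  have rs: "s \<le> r" "r \<le> t" using r(1) by (auto simp: Z_def)
  with assms have r0: "0 \<le> r" by linarith
  have above: "\<E> (S r x) \<le> \<E> (S q x)" if "r \<le> q" "q \<le> t" for q
  proof (cases "q = r")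
    case False
    then have "q \<notin> Z" using r(2)[of q] that by auto
    then have "\<E> (S s x) < \<E> (S q x)" using that rs by (auto simp: Z_def not_le)
    then show ?thesis using r(1) by (auto simp: Z_def)
  qed simp
  have rD: "S r x \<in> D" using r(1) neg by (auto simp: Z_def D_iff not_le)
  define g where "g q = (dist (S q x) (S r x))\<^sup>2" for q
  have "exp (\<kappa> * t) * g t \<le> exp (\<kappa> * r) * g r"
  proof (rule dini_le_gronwall)
    show "continuous_on {r..t} g" unfolding g_def
      by (intro continuous_intros continuous_on_subset[OF cont]) (use rs r0 in auto)
    fix q assume q: "r \<le> q" "q < t"
    have "dini_le g q (2 * (e (S r x) - e (S r x)) - \<kappa> * g q)"
      unfolding g_def using above[of q] q rs r0 energy_eq[OF rD] by (intro evi rD) auto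
    then show "dini_le g q (- \<kappa> * g q)" by simp
  qed (use rs r0 in auto)
  then have "g t \<le> 0" by (simp add: g_def mult_le_0_iff)
  then have "S t x = S r x" by (simp add: g_def)
  then show False using r(1) neg by (simp add: Z_def)
qed

lemma S_in_D: "x \<in> D \<Longrightarrow> t \<ge> 0 \<Longrightarrow> S t x \<in> D"
  using orbit_in_D[of t x] by (cases "t = 0") auto

lemma e_decreasing:
  assumes "x \<in> D" "0 \<le> s" "s \<le> t" shows "e (S t x) \<le> e (S s x)"
  using energy_decreasing[OF assms(2,3), of x] energy_eq[of "S t x"] energy_eq[of "S s x"]
    S_in_D assms by simp

text \<open>The increment of the squared distance is split by moving first \<open>y\<close> with \<open>x\<close> fixed and then \<open>x\<close> with \<open>y\<close>
  at its new position. In each part EVI produces a difference of energies, and the two differences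
  cancel in the limit: the energy of the new position of \<open>y\<close> is not larger than before, and that of \<open>x\<close> is
  not much smaller by lower semicontinuity.\<close>

lemma dini_le_dist_orbits:
  assumes xy: "x \<in> D" "y \<in> D" and t: "t \<ge> 0"
  shows "dini_le (\<lambda>s. (dist (S s x) (S s y))\<^sup>2) t (- (2 * \<kappa>) * (dist (S t x) (S t y))\<^sup>2)"
  unfolding dini_le_def
proof (intro allI impI)
  fix \<epsilon> :: real assume \<epsilon>: "\<epsilon> > 0"
  let ?p = "\<lambda>s. S s x" and ?q = "\<lambda>s. S s y"
  define F where "F s = (dist (?p s) (?q s))\<^sup>2" for s
  define \<eta> where "\<eta> = \<epsilon> / 4"
  have \<eta>: "\<eta> > 0" using \<epsilon> by (simp add: \<eta>_def)
  have D: "?p s \<in> D" "?q s \<in> D" if "s \<ge> t" for s using that t xy by (auto intro: S_in_D)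
  have gt: "\<forall>\<^sub>F s in at_right t. s > t" by (simp add: eventually_at_filter)
  have "dini_le (\<lambda>s. (dist (?q s) (?p t))\<^sup>2) t (2 * (e (?p t) - e (?q t)) - \<kappa> * F t)"
    using evi_D[OF D(1)[OF order_refl] t D(2)[OF order_refl]] by (simp add: F_def dist_commute)
  then have 1: "\<forall>\<^sub>F s in at_right t. (dist (?q s) (?p t))\<^sup>2 - F t
      \<le> (2 * (e (?p t) - e (?q t)) - \<kappa> * F t + \<eta>) * (s - t)"
    using \<eta> by (simp add: dini_le_def F_def dist_commute)
  have "\<forall>\<^sub>F z in nhds (?p t). ereal (e (?p t) - \<eta>) < \<E> z"
    using \<eta> energy_eq[OF D(1)] by (intro lsc_eventually_less lsc) auto
  then have 2: "\<forall>\<^sub>F s in at_right t. ereal (e (?p t) - \<eta>) < \<E> (?p s)"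
    using orbit_tendsto[OF t, of x] by (auto simp: filterlim_iff)
  have "((\<lambda>z. - \<kappa> * (dist (fst z) (snd z))\<^sup>2) \<longlongrightarrow>
      - \<kappa> * (dist (fst (?p t, ?q t)) (snd (?p t, ?q t)))\<^sup>2) (nhds (?p t, ?q t))"
    by (intro tendsto_intros tendsto_ident_at) (auto intro: tendsto_fst tendsto_snd filterlim_ident)
  then have "\<forall>\<^sub>F z in nhds (?p t, ?q t). - \<kappa> * (dist (fst z) (snd z))\<^sup>2 < - \<kappa> * F t + \<eta>"
    by (rule order_tendstoD(2)) (simp add: F_def \<eta>)
  then obtain P Q where PQ: "eventually P (nhds (?p t))" "eventually Q (nhds (?q t))"
    "\<And>a b. P a \<Longrightarrow> Q b \<Longrightarrow> - \<kappa> * (dist a b)\<^sup>2 < - \<kappa> * F t + \<eta>"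
    unfolding nhds_prod eventually_prod_filter by auto
  have Qe: "\<forall>\<^sub>F s in at_right t. Q (?q s)"
    using orbit_tendsto[OF t, of y] PQ(2) by (auto simp: filterlim_iff)
  have "\<forall>\<^sub>F s in at_right t. P (?p s)"
    using orbit_tendsto[OF t, of x] PQ(1) by (auto simp: filterlim_iff)
  then obtain t' where t': "t' > t" "\<And>s. t < s \<Longrightarrow> s < t' \<Longrightarrow> P (?p s)"
    unfolding eventually_at_right_field by blast
  moreover have "P (?p t)" using PQ(1) by (rule eventually_nhds_x_imp_x)
  ultimately have P: "P (?p s)" if "t \<le> s" "s < t'" for s
    using that by (cases "s = t") auto
  have "\<forall>\<^sub>F s in at_right t. s < t'"
    using t'(1) unfolding eventually_at_right_field by blast
  with 1 2 Qe gt show "\<forall>\<^sub>F s in at_right t. (dist (?p s) (?q s))\<^sup>2 - (dist (?p t) (?q t))\<^sup>2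
      \<le> (- (2 * \<kappa>) * (dist (?p t) (?q t))\<^sup>2 + \<epsilon>) * (s - t)"
  proof eventually_elim
    case (elim s)
    define c where "c = 2 * (e (?q s) - e (?p s)) + (- \<kappa> * F t + \<eta>)"
    \<comment> \<open>Since the energy decreases along the orbit, its value at the end of the time step bounds it from
      below during the whole step, which makes the constant \<open>c\<close> uniform.\<close>
    have "(dist (?p s) (?q s))\<^sup>2 - (dist (?p t) (?q s))\<^sup>2 \<le> c * (s - t)"
    proof (rule dini_le_mean_value)
      show "continuous_on {t..s} (\<lambda>r. (dist (?p r) (?q s))\<^sup>2)"
        by (intro continuous_intros continuous_on_subset[OF orbit_continuous]) (use t in auto)
      fix r assume r: "t \<le> r" "r < s"
      have "dini_le (\<lambda>r. (dist (?p r) (?q s))\<^sup>2) r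
          (2 * (e (?q s) - e (?p r)) - \<kappa> * (dist (?p r) (?q s))\<^sup>2)"
        using r t by (intro evi_D D) auto
      moreover have "e (?p s) \<le> e (?p r)" using r t xy by (intro e_decreasing) auto
      moreover have "- \<kappa> * (dist (?p r) (?q s))\<^sup>2 < - \<kappa> * F t + \<eta>"
        using r elim by (intro PQ(3) P) auto
      ultimately show "dini_le (\<lambda>r. (dist (?p r) (?q s))\<^sup>2) r c"
        by (elim dini_le_mono) (simp add: c_def)
    qed (use elim in simp)
    moreover have "c * (s - t) \<le> (2 * (e (?q t) - e (?p t) + \<eta>) + (- \<kappa> * F t + \<eta>)) * (s - t)"
    proof (rule mult_right_mono)
      have "e (?q s) \<le> e (?q t)" using elim t xy by (intro e_decreasing) auto
      moreover have "e (?p t) - \<eta> < e (?p s)" using elim energy_eq[OF D(1), of s] by simp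
      ultimately show "c \<le> 2 * (e (?q t) - e (?p t) + \<eta>) + (- \<kappa> * F t + \<eta>)"
        by (simp add: c_def)
    qed (use elim in simp)
    ultimately have "F s - F t \<le> (2 * (e (?p t) - e (?q t)) - \<kappa> * F t + \<eta>) * (s - t) +
        (2 * (e (?q t) - e (?p t) + \<eta>) + (- \<kappa> * F t + \<eta>)) * (s - t)"
      using elim(1) by (simp add: F_def dist_commute)
    also have "\<dots> = (- (2 * \<kappa>) * F t + \<epsilon>) * (s - t)" by (simp add: \<eta>_def field_simps)
    finally show ?case by (simp add: F_def)
  qed
qed

text \<open>Gronwall's inequality for the squared distance, first for starting points of finite energy. Every
  orbit enters the domain immediately, which gives the general case in the limit.\<close>

lemma contraction:
  assumes t: "t \<ge> 0" shows "dist (S t x) (S t y) \<le> exp (- \<kappa> * t) * dist x y"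
proof -
  have *: "exp (\<kappa> * t) * dist (S t x) (S t y) \<le> dist x y" if xy: "x \<in> D" "y \<in> D" for x y
  proof -
    have "exp (2 * \<kappa> * t) * (dist (S t x) (S t y))\<^sup>2 \<le> exp (2 * \<kappa> * 0) * (dist (S 0 x) (S 0 y))\<^sup>2"
    proof (rule dini_le_gronwall[OF t])
      show "continuous_on {0..t} (\<lambda>s. (dist (S s x) (S s y))\<^sup>2)"
        by (intro continuous_intros continuous_on_subset[OF orbit_continuous]) auto
    qed (rule dini_le_dist_orbits[OF xy])
    then have "(exp (\<kappa> * t) * dist (S t x) (S t y))\<^sup>2 \<le> (dist x y)\<^sup>2"
      by (simp add: power_mult_distrib exp_double[symmetric] mult.assoc)
    then show ?thesis by (rule power2_le_imp_le) simp
  qed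
  have lim: "((\<lambda>r. S r z) \<longlongrightarrow> z) (at_right 0)" for z
    using orbit_tendsto[of 0 z] by simp
  have lim2: "((\<lambda>r. S t (S r z)) \<longlongrightarrow> S t z) (at_right 0)" for z
    by (rule continuous_on_tendsto_compose[OF S_continuous[OF t] lim]) auto
  have "exp (\<kappa> * t) * dist (S t x) (S t y) \<le> dist x y"
  proof (rule tendsto_le)
    show "((\<lambda>r. dist (S r x) (S r y)) \<longlongrightarrow> dist x y) (at_right 0)"
      by (intro tendsto_intros lim)
    show "((\<lambda>r. exp (\<kappa> * t) * dist (S t (S r x)) (S t (S r y))) \<longlongrightarrow>
        exp (\<kappa> * t) * dist (S t x) (S t y)) (at_right 0)"
      by (intro tendsto_intros lim2)
    have "\<forall>\<^sub>F r in at_right 0. (r::real) > 0" by (simp add: eventually_at_filter)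
    then show "\<forall>\<^sub>F r in at_right 0. exp (\<kappa> * t) * dist (S t (S r x)) (S t (S r y))
        \<le> dist (S r x) (S r y)"
      by eventually_elim (intro *, auto intro: orbit_in_D)
  qed simp
  then show ?thesis by (simp add: exp_minus field_simps)
qed

text \<open>The weighted sum \<open>(1 - s) d\<^sup>2(_, \<rho>) + s d\<^sup>2(_, \<pi>)\<close> is minimal at the point \<open>\<zeta> s\<close>, so it cannot decrease
  along the flow started there. EVI at time 0 bounds its derivative by an expression that would be
  negative if the convexity inequality failed. An infinite energy at \<open>\<zeta> s\<close> is excluded by the same argument,
  so geodesics between points of the domain stay in it.\<close>

lemma geodesic_convex:
  assumes \<zeta>: "geodesic \<zeta> \<rho> \<pi>" and D: "\<rho> \<in> D" "\<pi> \<in> D" and s: "s \<in> {0..1}"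
  shows "\<zeta> s \<in> D"
    and "e (\<zeta> s) \<le> (1 - s) * e \<rho> + s * e \<pi> - \<kappa> / 2 * s * (1 - s) * (dist \<rho> \<pi>)\<^sup>2"
proof -
  define R where "R = (1 - s) * e \<rho> + s * e \<pi> - \<kappa> / 2 * s * (1 - s) * (dist \<rho> \<pi>)\<^sup>2"
  let ?x = "\<zeta> s"
  let ?d = "dist \<rho> \<pi>"
  have ends: "\<zeta> 0 = \<rho>" "\<zeta> 1 = \<pi>" using \<zeta> by (auto simp: geodesic_def)
  have d: "dist ?x \<rho> = s * ?d" "dist ?x \<pi> = (1 - s) * ?d"
  proof -
    have *: "dist (\<zeta> p) (\<zeta> q) = \<bar>q - p\<bar> * ?d" if "p \<in> {0..1}" "q \<in> {0..1}" for p q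
      using \<zeta> that by (simp add: geodesic_def)
    show "dist ?x \<rho> = s * ?d" "dist ?x \<pi> = (1 - s) * ?d"
      using *[of s 0] *[of s 1] s by (simp_all add: ends)
  qed
  have le: "\<E> ?x \<le> ereal R"
  proof (rule ccontr)
    assume "\<not> ?thesis"
    then obtain r where r: "R < r" "ereal r \<le> \<E> ?x"
      using ereal_dense2[of "ereal R" "\<E> ?x"] by (auto simp: not_le)
    have "dini_le (\<lambda>h. (1 - s) * (dist (S h ?x) \<rho>)\<^sup>2 + s * (dist (S h ?x) \<pi>)\<^sup>2) 0
        ((1 - s) * (2 * (e \<rho> - r) - \<kappa> * (dist (S 0 ?x) \<rho>)\<^sup>2)
          + s * (2 * (e \<pi> - r) - \<kappa> * (dist (S 0 ?x) \<pi>)\<^sup>2))"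
      using s r(2) by (intro dini_le_linear_combination evi D) auto
    moreover have "(1 - s) * (dist (S 0 ?x) \<rho>)\<^sup>2 + s * (dist (S 0 ?x) \<pi>)\<^sup>2 - 0 * (h - 0)
        \<le> (1 - s) * (dist (S h ?x) \<rho>)\<^sup>2 + s * (dist (S h ?x) \<pi>)\<^sup>2" for h
    proof -
      define p q where "p = dist (S h ?x) \<rho>" and "q = dist (S h ?x) \<pi>"
      have "?d \<le> p + q" unfolding p_def q_def by (metis dist_commute dist_triangle)
      then have "?d\<^sup>2 \<le> (p + q)\<^sup>2" by (intro power_mono) auto
      then have "s * (1 - s) * ?d\<^sup>2 \<le> s * (1 - s) * (p + q)\<^sup>2"
        using s by (intro mult_left_mono) auto
      also have "\<dots> = (1 - s) * p\<^sup>2 + s * q\<^sup>2 - ((1 - s) * p - s * q)\<^sup>2"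
        by (simp add: power2_eq_square algebra_simps)
      also have "\<dots> \<le> (1 - s) * p\<^sup>2 + s * q\<^sup>2" by simp
      also have "s * (1 - s) * ?d\<^sup>2 = (1 - s) * (s * ?d)\<^sup>2 + s * ((1 - s) * ?d)\<^sup>2"
        by (simp add: power2_eq_square algebra_simps)
      finally show ?thesis by (simp add: d p_def q_def)
    qed
    ultimately have "- 0 \<le> (1 - s) * (2 * (e \<rho> - r) - \<kappa> * (dist (S 0 ?x) \<rho>)\<^sup>2)
          + s * (2 * (e \<pi> - r) - \<kappa> * (dist (S 0 ?x) \<pi>)\<^sup>2)"
      by (rule dini_le_of_min)
    also have "\<dots> = 2 * (R - r)"
      by (simp add: d R_def power2_eq_square field_simps)
    finally show False using r(1) by simp
  qed
  then show "?x \<in> D" by (rule D_I)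
  with le show "e ?x \<le> (1 - s) * e \<rho> + s * e \<pi> - \<kappa> / 2 * s * (1 - s) * ?d\<^sup>2"
    using energy_eq[of ?x] by (simp add: R_def)
qed

section \<open>The Tataru distance\<close>

abbreviation d\<^sub>T where "d\<^sub>T \<equiv> tataru_dist \<kappa> S"

abbreviation k where "k \<equiv> min 0 \<kappa>"

text \<open>The weight \<open>exp (k t)\<close> absorbs the factor by which the flow may expand distances; this is the purpose
  of the exponential in the Tataru distance.\<close>

lemma contraction_weighted:
  assumes "s \<ge> 0" "t \<ge> 0"
  shows "exp (k * (t + s)) * dist (S s x) (S s y) \<le> exp (k * t) * dist x y"
proof -
  have "exp (k * (t + s)) * dist (S s x) (S s y) \<le> exp (k * (t + s)) * (exp (- \<kappa> * s) * dist x y)"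
    by (intro mult_left_mono contraction assms) auto
  also have "\<dots> = exp (k * t + (k - \<kappa>) * s) * dist x y"
    by (simp add: exp_add[symmetric] mult.assoc[symmetric] algebra_simps)
  also have "\<dots> \<le> exp (k * t) * dist x y"
    using assms by (intro mult_right_mono) (auto simp: mult_le_0_iff)
  finally show ?thesis .
qed

lemma tataru_bdd: "bdd_below ((\<lambda>t. t + exp (k * t) * dist x (S t y)) ` {0..})"
  by (rule bdd_belowI[of _ 0]) auto

lemma tataru_le: "t \<ge> 0 \<Longrightarrow> d\<^sub>T x y \<le> t + exp (k * t) * dist x (S t y)"
  unfolding tataru_dist_def by (rule cINF_lower[OF tataru_bdd]) simp

lemma tataru_nonneg: "d\<^sub>T x y \<ge> 0"
  unfolding tataru_dist_def by (rule cINF_greatest) auto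

lemma tataru_witness:
  assumes "d\<^sub>T x y < c"
  obtains t where "t \<ge> 0" "t + exp (k * t) * dist x (S t y) < c"
  using assms unfolding tataru_dist_def by (subst (asm) cINF_less_iff[OF _ tataru_bdd]) auto

lemma tataru_le_dist: "d\<^sub>T x y \<le> dist x y"
  using tataru_le[of 0 x y] by simp

lemma tataru_refl [simp]: "d\<^sub>T x x = 0"
  using tataru_le_dist[of x x] tataru_nonneg[of x x] by simp

lemma tataru_flow: "t \<ge> 0 \<Longrightarrow> d\<^sub>T (S t x) x \<le> t"
  using tataru_le[of t "S t x" x] by simp

lemma tataru_triangle: "d\<^sub>T x z \<le> d\<^sub>T x y + d\<^sub>T y z"
proof (rule field_le_epsilon)
  fix \<epsilon> :: real assume "\<epsilon> > 0"
  then have "d\<^sub>T x y < d\<^sub>T x y + \<epsilon> / 2" "d\<^sub>T y z < d\<^sub>T y z + \<epsilon> / 2" by auto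
  then obtain s t where s: "s \<ge> 0" "s + exp (k * s) * dist x (S s y) < d\<^sub>T x y + \<epsilon> / 2"
    and t: "t \<ge> 0" "t + exp (k * t) * dist y (S t z) < d\<^sub>T y z + \<epsilon> / 2"
    by (metis tataru_witness)
  have "d\<^sub>T x z \<le> (t + s) + exp (k * (t + s)) * dist x (S (t + s) z)"
    using s t by (intro tataru_le) auto
  also have "\<dots> \<le> (t + s) + exp (k * (t + s)) * (dist x (S s y) + dist (S s y) (S s (S t z)))"
    using s t S_add[of s t z] by (intro add_left_mono mult_left_mono) (auto intro: dist_triangle)
  also have "\<dots> = (t + s) + exp (k * (t + s)) * dist x (S s y)
      + exp (k * (t + s)) * dist (S s y) (S s (S t z))"
    by (simp add: algebra_simps)
  also have "\<dots> \<le> (t + s) + exp (k * s) * dist x (S s y) + exp (k * t) * dist y (S t z)"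
    using s t by (intro add_mono contraction_weighted mult_right_mono order_refl)
      (auto simp: mult_le_cancel_left)
  finally show "d\<^sub>T x z \<le> d\<^sub>T x y + d\<^sub>T y z + \<epsilon>" using s t by simp
qed

lemma tataru_continuous: "continuous_on UNIV (\<lambda>x. d\<^sub>T x y)"
proof -
  have "d\<^sub>T x y - d\<^sub>T z y \<le> dist x z" for x z
    using tataru_triangle[of x y z] tataru_le_dist[of x z] by simp
  then have "\<bar>d\<^sub>T x y - d\<^sub>T z y\<bar> \<le> dist x z" for x z
    by (smt (verit) dist_commute)
  then show ?thesis
    unfolding continuous_on_iff by (metis dist_real_def le_less_trans)
qed

lemma tataru_tendsto_0:
  assumes "(\<lambda>n. d\<^sub>T (X n) y) \<longlonglongrightarrow> 0" shows "X \<longlonglongrightarrow> y"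
proof (rule tendstoI)
  fix \<epsilon> :: real assume \<epsilon>: "\<epsilon> > 0"
  have "\<forall>\<^sub>F t in at_right 0. dist (S t y) y < \<epsilon> / 2"
    using tendstoD[OF orbit_tendsto[of 0 y], of "\<epsilon> / 2"] \<epsilon> by simp
  then obtain \<delta> where \<delta>: "\<delta> > 0" "\<And>t. 0 < t \<Longrightarrow> t < \<delta> \<Longrightarrow> dist (S t y) y < \<epsilon> / 2"
    unfolding eventually_at_right_field by auto
  define c where "c = min (min \<delta> 1) (\<epsilon> / 2 * exp k)"
  have "c > 0" using \<delta> \<epsilon> by (simp add: c_def)
  then have "\<forall>\<^sub>F n in sequentially. d\<^sub>T (X n) y < c" using order_tendstoD(2)[OF assms] by blast
  then show "\<forall>\<^sub>F n in sequentially. dist (X n) y < \<epsilon>"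
  proof eventually_elim
    case (elim n)
    then obtain t where t: "t \<ge> 0" "t + exp (k * t) * dist (X n) (S t y) < c"
      by (rule tataru_witness)
    have "0 \<le> exp (k * t) * dist (X n) (S t y)" by simp
    moreover have "c \<le> \<delta>" "c \<le> 1" by (auto simp: c_def)
    ultimately have tc: "t < \<delta>" "t \<le> 1" using t by linarith+
    have "k * 1 \<le> k * t" using tc by (intro mult_left_mono_neg) auto
    then have "exp k * dist (X n) (S t y) \<le> exp (k * t) * dist (X n) (S t y)"
      by (intro mult_right_mono) auto
    also have "\<dots> < \<epsilon> / 2 * exp k" using t by (simp add: c_def)
    finally have "dist (X n) (S t y) < \<epsilon> / 2" by simp
    moreover have "dist (S t y) y < \<epsilon> / 2" using \<delta> tc t \<epsilon> by (cases "t = 0") auto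
    ultimately show ?case using dist_triangle[of "X n" y "S t y"] by linarith
  qed
qed

text \<open>The steps are witnessed by times \<open>\<tau> n\<close> with a finite sum, such that \<open>X (n + 1)\<close> is close to the point reached from
  \<open>X n\<close> in time \<open>\<tau> n\<close>. By contraction, \<open>X (n + m)\<close> is close to the point reached from \<open>X n\<close> in time
  \<open>T n m = \<tau> n + \<dots> + \<tau> (n + m - 1)\<close>. As \<open>m\<close> grows these times converge, hence so do the points on
  the orbit of \<open>X n\<close>, and the tail of \<open>X\<close> stays near their limit.\<close>

lemma tataru_complete:
  fixes X :: "nat \<Rightarrow> 'a"
  assumes X: "\<And>n. d\<^sub>T (X (Suc n)) (X n) \<le> (1/2) ^ n"
  shows "Cauchy X"
proof -
  have "\<exists>t. t \<ge> 0 \<and> t + exp (k * t) * dist (X (Suc n)) (S t (X n)) < 2 * (1/2) ^ n" for n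
  proof -
    have "d\<^sub>T (X (Suc n)) (X n) < 2 * (1/2) ^ n" using X[of n]
      by (rule le_less_trans) simp
    then obtain t where "t \<ge> 0" "t + exp (k * t) * dist (X (Suc n)) (S t (X n)) < 2 * (1/2) ^ n"
      by (rule tataru_witness)
    then show ?thesis by blast
  qed
  then have "\<forall>n. \<exists>t. t \<ge> 0 \<and> t + exp (k * t) * dist (X (Suc n)) (S t (X n)) < 2 * (1/2) ^ n"
    by (rule allI)
  from choice[OF this] obtain \<tau> where \<tau>: "\<And>n. \<tau> n \<ge> 0"
      "\<And>n. \<tau> n + exp (k * \<tau> n) * dist (X (Suc n)) (S (\<tau> n) (X n)) < 2 * (1/2) ^ n"
    by blast
  have \<tau>_le: "\<tau> n \<le> 2 * (1/2) ^ n" for n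
  proof -
    have "0 \<le> exp (k * \<tau> n) * dist (X (Suc n)) (S (\<tau> n) (X n))" by simp
    then show ?thesis using \<tau>(2)[of n] by linarith
  qed
  have geo: "summable (\<lambda>n. 2 * (1/2::real) ^ n)" by (intro summable_mult summable_geometric) simp
  have sum_\<tau>: "summable \<tau>"
    by (rule summable_comparison_test[OF _ geo]) (use \<tau>(1) \<tau>_le in simp)
  define T where "T n m = sum \<tau> {n..<n + m}" for n m
  have T_nonneg: "T n m \<ge> 0" for n m unfolding T_def by (rule sum_nonneg) (rule \<tau>(1))
  have T_le: "T n m \<le> suminf \<tau>" for n m
    unfolding T_def by (rule sum_le_suminf[OF sum_\<tau>]) (simp_all add: \<tau>(1))
  have T_lim: "\<exists>L. T n \<longlonglongrightarrow> L \<and> L \<ge> 0" for n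
  proof -
    have "summable (\<lambda>i. \<tau> (i + n))" by (rule summable_ignore_initial_segment[OF sum_\<tau>])
    then have "(\<lambda>m. \<Sum>i<m. \<tau> (i + n)) \<longlonglongrightarrow> (\<Sum>i. \<tau> (i + n))" by (rule summable_LIMSEQ)
    moreover have "(\<Sum>i<m. \<tau> (i + n)) = T n m" for m
      unfolding T_def by (rule sum.reindex_bij_witness[of _ "\<lambda>i. i - n" "\<lambda>i. i + n"]) auto
    ultimately have "T n \<longlonglongrightarrow> (\<Sum>i. \<tau> (i + n))" by simp
    moreover from this have "0 \<le> (\<Sum>i. \<tau> (i + n))"
      by (rule LIMSEQ_le_const) (use T_nonneg in simp)
    ultimately show ?thesis by blast
  qed
  have step: "exp (k * T n m) * dist (X (n + m)) (S (T n m) (X n)) \<le> (\<Sum>i<m. 2 * (1/2) ^ (n + i))" for n m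
  proof (induction m)
    case 0
    have "T n 0 = 0" by (simp add: T_def)
    then show ?case by simp
  next
    case (Suc m)
    let ?t = "\<tau> (n + m)"
    have T: "T n (Suc m) = T n m + ?t" by (simp add: T_def)
    have "exp (k * T n (Suc m)) * dist (X (n + Suc m)) (S (T n (Suc m)) (X n))
       \<le> exp (k * (T n m + ?t)) * (dist (X (Suc (n + m))) (S ?t (X (n + m)))
            + dist (S ?t (X (n + m))) (S ?t (S (T n m) (X n))))"
      unfolding T S_add[OF \<tau>(1) T_nonneg] add_Suc_right
      by (intro mult_left_mono dist_triangle) simp
    also have "\<dots> = exp (k * (T n m + ?t)) * dist (X (Suc (n + m))) (S ?t (X (n + m)))
        + exp (k * (T n m + ?t)) * dist (S ?t (X (n + m))) (S ?t (S (T n m) (X n)))"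
      by (simp add: algebra_simps)
    also have "\<dots> \<le> exp (k * ?t) * dist (X (Suc (n + m))) (S ?t (X (n + m)))
        + exp (k * T n m) * dist (X (n + m)) (S (T n m) (X n))"
    proof (intro add_mono contraction_weighted mult_right_mono)
      have "k * T n m \<le> 0" using T_nonneg by (intro mult_nonpos_nonneg) auto
      then show "exp (k * (T n m + ?t)) \<le> exp (k * ?t)" by (simp add: distrib_left)
    qed (use \<tau>(1) T_nonneg in auto)
    also have "\<dots> \<le> 2 * (1/2) ^ (n + m) + (\<Sum>i<m. 2 * (1/2) ^ (n + i))"
      using \<tau>(1)[of "n + m"] \<tau>(2)[of "n + m"] by (intro add_mono Suc.IH) linarith
    finally show ?case by simp
  qed
  have near: "dist (X (n + m)) (S (T n m) (X n)) \<le> exp (- k * suminf \<tau>) * (4 * (1/2) ^ n)" for n m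
  proof -
    have sum: "(\<Sum>i<m. 2 * (1/2) ^ (n + i)) \<le> (4 * (1/2) ^ n :: real)"
    proof -
      have "(\<Sum>i<m. 2 * (1/2) ^ (n + i)) = 2 * (1/2) ^ n * (\<Sum>i<m. (1/2::real) ^ i)"
        by (simp add: power_add sum_distrib_left mult.assoc)
      also have "\<dots> \<le> 2 * (1/2) ^ n * 2"
        by (intro mult_left_mono) (simp_all add: sum_gp_strict)
      finally show ?thesis by simp
    qed
    have "exp (k * suminf \<tau>) * dist (X (n + m)) (S (T n m) (X n))
        \<le> exp (k * T n m) * dist (X (n + m)) (S (T n m) (X n))"
      using T_le by (intro mult_right_mono) (auto intro: mult_left_mono_neg)
    also have "\<dots> \<le> 4 * (1/2) ^ n" using step sum by (rule order_trans)
    finally have "exp (k * suminf \<tau>) * dist (X (n + m)) (S (T n m) (X n)) \<le> 4 * (1/2) ^ n" .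
    then show ?thesis by (simp add: exp_minus field_simps)
  qed
  show ?thesis
  proof (rule metric_CauchyI)
    fix \<epsilon> :: real assume \<epsilon>: "\<epsilon> > 0"
    have "(\<lambda>n. exp (- k * suminf \<tau>) * (4 * (1/2) ^ n)) \<longlonglongrightarrow> exp (- k * suminf \<tau>) * (4 * 0)"
      by (intro tendsto_intros LIMSEQ_realpow_zero) auto
    then have "\<forall>\<^sub>F n in sequentially. exp (- k * suminf \<tau>) * (4 * (1/2) ^ n) < \<epsilon> / 4"
      by (rule order_tendstoD(2)) (use \<epsilon> in simp)
    then obtain n where n: "exp (- k * suminf \<tau>) * (4 * (1/2) ^ n) < \<epsilon> / 4"
      unfolding eventually_sequentially by blast
    obtain L where L: "T n \<longlonglongrightarrow> L" "L \<ge> 0" using T_lim by blast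
    have "(\<lambda>m. S (T n m) (X n)) \<longlonglongrightarrow> S L (X n)"
      by (rule continuous_on_tendsto_compose[OF orbit_continuous L(1)]) (use L T_nonneg in auto)
    then have "\<forall>\<^sub>F m in sequentially. dist (S (T n m) (X n)) (S L (X n)) < \<epsilon> / 4"
      by (rule tendstoD) (use \<epsilon> in simp)
    then obtain M where M: "\<And>m. m \<ge> M \<Longrightarrow> dist (S (T n m) (X n)) (S L (X n)) < \<epsilon> / 4"
      unfolding eventually_sequentially by blast
    have *: "dist (X m) (S L (X n)) < \<epsilon> / 2" if "m \<ge> n + M" for m
    proof -
      have "dist (X m) (S (T n (m - n)) (X n)) < \<epsilon> / 4" using near[of n "m - n"] n that by simp
      moreover have "dist (S (T n (m - n)) (X n)) (S L (X n)) < \<epsilon> / 4" using that by (intro M) simp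
      ultimately show ?thesis using dist_triangle[of "X m" "S L (X n)" "S (T n (m - n)) (X n)"] by linarith
    qed
    show "\<exists>M. \<forall>m\<ge>M. \<forall>n\<ge>M. dist (X m) (X n) < \<epsilon>"
      by (intro exI[of _ "n + M"] allI impI) (rule dist_triangle_half_l[OF * *])
  qed
qed

section \<open>Stationarity of the auxiliary points\<close>

text \<open>First order condition at a penalized minimum when \<open>\<rho>\<close> moves along its flow: the energy penalty
  decreases, the perturbation grows at most linearly with slope \<open>b\<close>, and EVI bounds the derivative of the two squared
  distances.\<close>

lemma flow_stationarity:
  assumes D: "\<rho> \<in> D" "\<sigma> \<in> D" "\<tau> \<in> D" and a: "a \<ge> 0" and b: "b \<ge> 0"
    and min: "\<And>\<rho>'. \<rho>' \<in> D \<Longrightarrow> a / 2 * ((dist \<rho> \<sigma>)\<^sup>2 + (dist \<rho> \<tau>)\<^sup>2) + b * max 0 (e \<rho>)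
      \<le> a / 2 * ((dist \<rho>' \<sigma>)\<^sup>2 + (dist \<rho>' \<tau>)\<^sup>2) + b * max 0 (e \<rho>') + b * d\<^sub>T \<rho>' \<rho>"
  shows "a * (e \<rho> - e \<sigma>) \<le> a * (e \<tau> - e \<rho>)
    - a * \<kappa> / 2 * ((dist \<rho> \<sigma>)\<^sup>2 + (dist \<rho> \<tau>)\<^sup>2) + b"
proof -
  let ?g = "\<lambda>s. a / 2 * (dist (S s \<rho>) \<sigma>)\<^sup>2 + a / 2 * (dist (S s \<rho>) \<tau>)\<^sup>2"
  have "dini_le ?g 0 (a / 2 * (2 * (e \<sigma> - e (S 0 \<rho>)) - \<kappa> * (dist (S 0 \<rho>) \<sigma>)\<^sup>2)
      + a / 2 * (2 * (e \<tau> - e (S 0 \<rho>)) - \<kappa> * (dist (S 0 \<rho>) \<tau>)\<^sup>2))"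
    using a by (intro dini_le_linear_combination evi_D D) (auto simp: D)
  moreover have "?g 0 - b * (s - 0) \<le> ?g s" if "s > 0" for s
  proof -
    have "b * max 0 (e (S s \<rho>)) \<le> b * max 0 (e \<rho>)"
      using e_decreasing[OF D(1), of 0 s] that b by (intro mult_left_mono) auto
    moreover have "b * d\<^sub>T (S s \<rho>) \<rho> \<le> b * s"
      using that b by (intro mult_left_mono tataru_flow) auto
    ultimately show ?thesis
      using min[OF S_in_D[OF D(1), of s]] that by (simp add: distrib_left)
  qed
  ultimately have "- b \<le> a / 2 * (2 * (e \<sigma> - e (S 0 \<rho>)) - \<kappa> * (dist (S 0 \<rho>) \<sigma>)\<^sup>2)
      + a / 2 * (2 * (e \<tau> - e (S 0 \<rho>)) - \<kappa> * (dist (S 0 \<rho>) \<tau>)\<^sup>2)"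
    by (rule dini_le_of_min)
  then show ?thesis by (simp add: field_simps)
qed

text \<open>First order condition when \<open>\<rho>\<close> moves towards \<open>\<sigma>\<close>: after a fraction \<open>s\<close> of the geodesic the distance to
  \<open>\<sigma>\<close> has decreased by \<open>s d(\<rho>, \<sigma>)\<close> and the distance to \<open>\<tau>\<close> has grown by no more than that. By convexity the
  energy grows at most with slope \<open>\<E>(\<sigma>) - \<E>(\<rho>) + \<bar>\<kappa>\<bar>/2 d\<^sup>2(\<rho>, \<sigma>)\<close>.\<close>

lemma geodesic_stationarity:
  assumes D: "\<rho> \<in> D" "\<sigma> \<in> D" "\<tau> \<in> D" and a: "a \<ge> 0" and b: "b \<ge> 0"
    and geo: "\<exists>\<zeta>. geodesic \<zeta> \<rho> \<sigma>"
    and min: "\<And>\<rho>'. \<rho>' \<in> D \<Longrightarrow> a / 2 * ((dist \<rho> \<sigma>)\<^sup>2 + (dist \<rho> \<tau>)\<^sup>2) + b * max 0 (e \<rho>)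
      \<le> a / 2 * ((dist \<rho>' \<sigma>)\<^sup>2 + (dist \<rho>' \<tau>)\<^sup>2) + b * max 0 (e \<rho>') + b * d\<^sub>T \<rho>' \<rho>"
  shows "a * (dist \<rho> \<sigma>)\<^sup>2 \<le> a * dist \<rho> \<sigma> * dist \<rho> \<tau>
    + b * (dist \<rho> \<sigma> + max 0 (e \<sigma> - e \<rho> + \<bar>\<kappa>\<bar> / 2 * (dist \<rho> \<sigma>)\<^sup>2))"
proof -
  define x y where "x = dist \<rho> \<sigma>" and "y = dist \<rho> \<tau>"
  have xy: "x \<ge> 0" "y \<ge> 0" by (auto simp: x_def y_def)
  define P where "P = max 0 (e \<sigma> - e \<rho> + \<bar>\<kappa>\<bar> / 2 * x\<^sup>2)"
  obtain \<zeta> where \<zeta>: "geodesic \<zeta> \<rho> \<sigma>" using geo by blast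
  have \<zeta>_dist: "dist (\<zeta> p) (\<zeta> q) = \<bar>q - p\<bar> * x" if "p \<in> {0..1}" "q \<in> {0..1}" for p q
    using \<zeta> that by (simp add: geodesic_def x_def)
  have ends: "\<zeta> 0 = \<rho>" "\<zeta> 1 = \<sigma>" using \<zeta> by (auto simp: geodesic_def)
  have step: "a * x\<^sup>2 \<le> a * x * y + b * (x + P) + s * (a * x\<^sup>2)" if s: "0 < s" "s < 1" for s
  proof -
    let ?p = "\<zeta> s"
    have pD: "?p \<in> D" using geodesic_convex(1)[OF \<zeta> D(1,2), of s] s by simp
    have d: "dist ?p \<rho> = s * x" "dist ?p \<sigma> = (1 - s) * x"
      using \<zeta>_dist[of s 0] \<zeta>_dist[of s 1] s by (simp_all add: ends)
    have "dist ?p \<tau> \<le> y + s * x"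
      using dist_triangle[of ?p \<tau> \<rho>] d(1) by (simp add: y_def)
    then have dt: "(dist ?p \<tau>)\<^sup>2 \<le> (y + s * x)\<^sup>2" by (intro power_mono) auto
    have "- \<kappa> / 2 * s * (1 - s) * x\<^sup>2 \<le> s * (\<bar>\<kappa>\<bar> / 2 * x\<^sup>2)"
    proof -
      have "- \<kappa> * (s * (1 - s) * x\<^sup>2) \<le> \<bar>\<kappa>\<bar> * (s * 1 * x\<^sup>2)"
        using s by (intro mult_mono) (auto intro!: mult_right_mono mult_left_mono)
      then show ?thesis by (simp add: mult.assoc mult.left_commute)
    qed
    moreover have "e ?p \<le> (1 - s) * e \<rho> + s * e \<sigma> - \<kappa> / 2 * s * (1 - s) * x\<^sup>2"
      using geodesic_convex(2)[OF \<zeta> D(1,2), of s] s by (simp add: x_def)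
    ultimately have "e ?p \<le> (1 - s) * e \<rho> + s * e \<sigma> + s * (\<bar>\<kappa>\<bar> / 2 * x\<^sup>2)"
      by linarith
    also have "\<dots> = e \<rho> + s * (e \<sigma> - e \<rho> + \<bar>\<kappa>\<bar> / 2 * x\<^sup>2)"
      by (simp add: algebra_simps)
    also have "\<dots> \<le> e \<rho> + s * P" using s by (intro add_left_mono mult_left_mono) (auto simp: P_def)
    finally have "e ?p \<le> e \<rho> + s * P" .
    moreover have "0 \<le> s * P" using s by (simp add: P_def)
    ultimately have "max 0 (e ?p) \<le> max 0 (e \<rho>) + s * P" by linarith
    then have "b * max 0 (e ?p) \<le> b * (max 0 (e \<rho>) + s * P)" using b by (rule mult_left_mono)
    moreover have "b * d\<^sub>T ?p \<rho> \<le> b * (s * x)"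
      using b tataru_le_dist[of ?p \<rho>] d(1) by (intro mult_left_mono) auto
    moreover have "a / 2 * ((dist ?p \<sigma>)\<^sup>2 + (dist ?p \<tau>)\<^sup>2) \<le> a / 2 * (((1 - s) * x)\<^sup>2 + (y + s * x)\<^sup>2)"
      using a dt by (intro mult_left_mono add_mono) (auto simp: d)
    ultimately have "a / 2 * (x\<^sup>2 + y\<^sup>2) + b * max 0 (e \<rho>)
        \<le> a / 2 * (((1 - s) * x)\<^sup>2 + (y + s * x)\<^sup>2) + b * (max 0 (e \<rho>) + s * P) + b * (s * x)"
      using min[OF pD] by (simp add: x_def y_def)
    then have "s * (a * x\<^sup>2) \<le> s * (a * x * y + b * (x + P) + s * (a * x\<^sup>2))"
      by (simp add: power2_eq_square field_simps)
    then show ?thesis using s by simp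
  qed
  have "a * x\<^sup>2 \<le> a * x * y + b * (x + P)"
  proof (rule tendsto_lowerbound)
    have "((\<lambda>s. a * x * y + b * (x + P) + s * (a * x\<^sup>2)) \<longlongrightarrow> a * x * y + b * (x + P) + 0 * (a * x\<^sup>2))
        (at_right 0)"
      by (intro tendsto_intros)
    then show "((\<lambda>s. a * x * y + b * (x + P) + s * (a * x\<^sup>2)) \<longlongrightarrow> a * x * y + b * (x + P))
        (at_right 0)" by simp
    have "\<forall>\<^sub>F s in at_right (0::real). 0 < s \<and> s < 1"
      unfolding eventually_at_right_field by (intro exI[of _ 1]) simp
    then show "\<forall>\<^sub>F s in at_right 0. a * x\<^sup>2 \<le> a * x * y + b * (x + P) + s * (a * x\<^sup>2)"
      by eventually_elim (use step in blast)
  qed simp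
  then show ?thesis by (simp add: x_def y_def P_def)
qed

section \<open>Testing the viscosity inequalities at a penalized maximum\<close>

text \<open>Common part of the tests for sub- and supersolutions, the latter with \<open>w = - v\<close>. The point \<open>\<pi>\<close>
  maximizes with perturbation \<open>b\<close>, whereas the test function contains \<open>2 b\<close>. The excess makes \<open>\<pi>\<close> a strict
  maximum and forces every maximizing sequence to converge to \<open>\<pi>\<close>. The viscosity inequality
  bounds the energy along the sequence from above, so it passes to the limit by lower
  semicontinuity of the energy, and \<open>\<pi>\<close> has finite energy.\<close>

lemma viscosity_test:
  assumes a: "a > 0" and b: "b > 0" and l: "l > 0"
    and h: "continuous_on UNIV h" and \<theta>: "continuous_on UNIV (\<theta> :: real \<Rightarrow> real)"
    and max: "\<And>y. w y - a / 2 * (dist y \<rho>)\<^sup>2 - b * d\<^sub>T y \<pi> \<le> w \<pi> - a / 2 * (dist \<pi> \<rho>)\<^sup>2"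
    and conv: "(\<lambda>n. w (X n) - a / 2 * (dist (X n) \<rho>)\<^sup>2 - 2 * b * d\<^sub>T (X n) \<pi>)
      \<longlonglongrightarrow> w \<pi> - a / 2 * (dist \<pi> \<rho>)\<^sup>2"
    and ineq: "\<And>\<epsilon>. \<epsilon> > 0 \<Longrightarrow> \<forall>\<^sub>F n in sequentially.
      \<E> (X n) \<le> ereal (e \<rho> + (\<theta> (dist (X n) \<rho>) + (h (X n) - w (X n) + \<epsilon>) / l) / a)"
  shows "\<pi> \<in> D" and "w \<pi> - h \<pi> \<le> l * (a * (e \<rho> - e \<pi>) + \<theta> (dist \<pi> \<rho>))"
proof -
  let ?m = "w \<pi> - a / 2 * (dist \<pi> \<rho>)\<^sup>2"
  let ?f = "\<lambda>n. w (X n) - a / 2 * (dist (X n) \<rho>)\<^sup>2 - 2 * b * d\<^sub>T (X n) \<pi>"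
  have "(\<lambda>n. (?m - ?f n) / b) \<longlonglongrightarrow> (?m - ?m) / b"
    using b by (intro tendsto_intros conv) simp
  then have up: "(\<lambda>n. (?m - ?f n) / b) \<longlonglongrightarrow> 0" by simp
  have dT0: "(\<lambda>n. d\<^sub>T (X n) \<pi>) \<longlonglongrightarrow> 0"
  proof (rule tendsto_sandwich[OF _ _ tendsto_const up])
    have "d\<^sub>T (X n) \<pi> \<le> (?m - ?f n) / b" for n
      using max[of "X n"] b by (simp add: pos_le_divide_eq algebra_simps)
    then show "\<forall>\<^sub>F n in sequentially. d\<^sub>T (X n) \<pi> \<le> (?m - ?f n) / b" by simp
  qed (simp add: tataru_nonneg)
  then have X: "X \<longlonglongrightarrow> \<pi>" by (rule tataru_tendsto_0)
  have "(\<lambda>n. ?f n + a / 2 * (dist (X n) \<rho>)\<^sup>2 + 2 * b * d\<^sub>T (X n) \<pi>)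
      \<longlonglongrightarrow> ?m + a / 2 * (dist \<pi> \<rho>)\<^sup>2 + 2 * b * 0"
    by (intro tendsto_intros conv X dT0)
  then have w: "(\<lambda>n. w (X n)) \<longlonglongrightarrow> w \<pi>" by simp
  have hX: "(\<lambda>n. h (X n)) \<longlonglongrightarrow> h \<pi>"
    by (rule continuous_on_tendsto_compose[OF h X]) auto
  have \<theta>X: "(\<lambda>n. \<theta> (dist (X n) \<rho>)) \<longlonglongrightarrow> \<theta> (dist \<pi> \<rho>)"
    by (rule continuous_on_tendsto_compose[OF \<theta>]) (auto intro: tendsto_intros X)
  have key: "\<E> \<pi> \<le> ereal (e \<rho> + (\<theta> (dist \<pi> \<rho>) + (h \<pi> - w \<pi> + \<epsilon>) / l) / a)" (is "_ \<le> ereal ?R")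
    if \<epsilon>: "\<epsilon> > 0" for \<epsilon>
  proof (rule ccontr)
    assume "\<not> ?thesis"
    then obtain r where r: "?R < r" "ereal r < \<E> \<pi>"
      using ereal_dense2[of "ereal ?R" "\<E> \<pi>"] by (auto simp: not_le)
    have "(\<lambda>n. e \<rho> + (\<theta> (dist (X n) \<rho>) + (h (X n) - w (X n) + \<epsilon>) / l) / a) \<longlonglongrightarrow> ?R"
      using a l by (intro tendsto_intros \<theta>X hX w) auto
    then have "\<forall>\<^sub>F n in sequentially.
        e \<rho> + (\<theta> (dist (X n) \<rho>) + (h (X n) - w (X n) + \<epsilon>) / l) / a < r"
      using r(1) by (rule order_tendstoD(2))
    moreover have "\<forall>\<^sub>F n in sequentially. ereal r < \<E> (X n)"
      using lsc_eventually_less[OF lsc r(2)] X by (auto simp: filterlim_iff)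
    moreover note ineq[OF \<epsilon>]
    ultimately have "\<forall>\<^sub>F n in sequentially. False"
    proof eventually_elim
      case (elim n)
      from elim(2,3) have "ereal r < ereal (e \<rho> + (\<theta> (dist (X n) \<rho>) + (h (X n) - w (X n) + \<epsilon>) / l) / a)"
        by (rule less_le_trans)
      with elim(1) show False by simp
    qed
    then show False by simp
  qed
  show \<pi>D: "\<pi> \<in> D" using key[of 1] by (intro D_I) simp
  show "w \<pi> - h \<pi> \<le> l * (a * (e \<rho> - e \<pi>) + \<theta> (dist \<pi> \<rho>))"
  proof (rule field_le_epsilon)
    fix \<epsilon> :: real assume "\<epsilon> > 0"
    from key[OF this] have "e \<pi> - e \<rho> \<le> (\<theta> (dist \<pi> \<rho>) + (h \<pi> - w \<pi> + \<epsilon>) / l) / a"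
      using energy_eq[OF \<pi>D] by simp
    then have "a * (e \<pi> - e \<rho>) \<le> \<theta> (dist \<pi> \<rho>) + (h \<pi> - w \<pi> + \<epsilon>) / l"
      using a by (simp add: pos_le_divide_eq mult.commute)
    then have "a * (e \<pi> - e \<rho>) - \<theta> (dist \<pi> \<rho>) \<le> (h \<pi> - w \<pi> + \<epsilon>) / l" by simp
    then have "(a * (e \<pi> - e \<rho>) - \<theta> (dist \<pi> \<rho>)) * l \<le> h \<pi> - w \<pi> + \<epsilon>"
      using l by (simp add: pos_le_divide_eq)
    then show "w \<pi> - h \<pi> \<le> l * (a * (e \<rho> - e \<pi>) + \<theta> (dist \<pi> \<rho>)) + \<epsilon>"
      by (simp add: algebra_simps)
  qed
qed

lemma subsolution_test:
  assumes sub: "viscosity_subsolution (H_dagger \<kappa> \<E> S) l h u"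
    and a: "a > 0" and b: "b > 0" and l: "l > 0" and h: "continuous_on UNIV h" and \<rho>: "\<rho> \<in> D"
    and max: "\<And>y. u y - a / 2 * (dist y \<rho>)\<^sup>2 - b * d\<^sub>T y \<pi> \<le> u \<pi> - a / 2 * (dist \<pi> \<rho>)\<^sup>2"
  shows "\<pi> \<in> D" and "u \<pi> - h \<pi> \<le> l * (a * (e \<rho> - e \<pi>) + (- a * (\<kappa> / 2) * (dist \<pi> \<rho>)\<^sup>2 + 2 * b
      + 1 / 2 * a\<^sup>2 * (dist \<pi> \<rho>)\<^sup>2 + a * (2 * b) * dist \<pi> \<rho> + 1 / 2 * (2 * b)\<^sup>2))"
proof -
  define f where "f = (\<lambda>y. 1 / 2 * a * (dist y \<rho>)\<^sup>2 + (2 * b) * d\<^sub>T y \<pi> + 0)"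
  define \<theta> where "\<theta> x = - a * (\<kappa> / 2) * x\<^sup>2 + 2 * b
      + 1 / 2 * a\<^sup>2 * x\<^sup>2 + a * (2 * b) * x + 1 / 2 * (2 * b)\<^sup>2" for x
  define g where "g = (\<lambda>y. ereal a * (\<E> \<rho> - \<E> y) + ereal (\<theta> (dist y \<rho>)))"
  have "(f, g) \<in> H_dagger \<kappa> \<E> S"
    unfolding H_dagger_def f_def g_def \<theta>_def using a b \<rho>
    by (intro CollectI exI[of _ a] exI[of _ "2 * b"] exI[of _ 0] exI[of _ \<pi>] exI[of _ \<rho>]) auto
  with sub obtain X where X: "(\<lambda>n. ereal (u (X n) - f (X n))) \<longlonglongrightarrow> (SUP y. ereal (u y - f y))"
    "limsup (\<lambda>n. ereal (u (X n)) - ereal l * g (X n) - ereal (h (X n))) \<le> 0"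
    unfolding viscosity_subsolution_def by blast
  have fmax: "u y - f y \<le> u \<pi> - f \<pi>" for y
  proof -
    have "0 \<le> b * d\<^sub>T y \<pi>" using b tataru_nonneg by simp
    then show ?thesis using max[of y] by (simp add: f_def)
  qed
  have "(SUP y. ereal (u y - f y)) = ereal (u \<pi> - f \<pi>)"
    by (intro antisym SUP_least SUP_upper) (auto simp: fmax)
  with X(1) have "(\<lambda>n. u (X n) - f (X n)) \<longlonglongrightarrow> u \<pi> - f \<pi>" by simp
  then have conv: "(\<lambda>n. u (X n) - a / 2 * (dist (X n) \<rho>)\<^sup>2 - 2 * b * d\<^sub>T (X n) \<pi>)
      \<longlonglongrightarrow> u \<pi> - a / 2 * (dist \<pi> \<rho>)\<^sup>2"
    by (simp add: f_def diff_diff_eq)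
  have ineq: "\<forall>\<^sub>F n in sequentially.
      \<E> (X n) \<le> ereal (e \<rho> + (\<theta> (dist (X n) \<rho>) + (h (X n) - u (X n) + \<epsilon>) / l) / a)"
    if \<epsilon>: "\<epsilon> > 0" for \<epsilon>
  proof -
    have "limsup (\<lambda>n. ereal (u (X n)) - ereal l * g (X n) - ereal (h (X n))) < ereal \<epsilon>"
      using X(2) \<epsilon> by (simp add: le_less_trans)
    from Limsup_lessD[OF this] show ?thesis
    proof eventually_elim
      case (elim n)
      show ?case
      proof (cases "\<E> (X n)")
        case (real r)
        with elim have "u (X n) - l * (a * (e \<rho> - r) + \<theta> (dist (X n) \<rho>)) - h (X n) < \<epsilon>"
          by (simp add: g_def energy_eq[OF \<rho>])
        then have "(a * (r - e \<rho>) - \<theta> (dist (X n) \<rho>)) * l < h (X n) - u (X n) + \<epsilon>"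
          by (simp add: algebra_simps)
        then have "a * (r - e \<rho>) - \<theta> (dist (X n) \<rho>) < (h (X n) - u (X n) + \<epsilon>) / l"
          using l by (simp add: pos_less_divide_eq)
        then have "r - e \<rho> < (\<theta> (dist (X n) \<rho>) + (h (X n) - u (X n) + \<epsilon>) / l) / a"
          by (subst pos_less_divide_eq[OF a]) (simp add: algebra_simps)
        then show ?thesis using real by simp
      next
        case PInf
        with elim show ?thesis using a l by (simp add: g_def energy_eq[OF \<rho>])
      next
        case MInf
        then show ?thesis using not_minfty by blast
      qed
    qed
  qed
  have \<theta>: "continuous_on UNIV \<theta>" unfolding \<theta>_def by (intro continuous_intros)
  show "\<pi> \<in> D" by (rule viscosity_test(1)[OF a b l h \<theta> max conv ineq])
  show "u \<pi> - h \<pi> \<le> l * (a * (e \<rho> - e \<pi>) + (- a * (\<kappa> / 2) * (dist \<pi> \<rho>)\<^sup>2 + 2 * b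
      + 1 / 2 * a\<^sup>2 * (dist \<pi> \<rho>)\<^sup>2 + a * (2 * b) * dist \<pi> \<rho> + 1 / 2 * (2 * b)\<^sup>2))"
    using viscosity_test(2)[OF a b l h \<theta> max conv ineq] by (simp add: \<theta>_def)
qed

lemma supersolution_test:
  assumes super: "viscosity_supersolution (H_ddagger \<kappa> \<E> S) l h v"
    and a: "a > 0" and b: "b > 0" and l: "l > 0" and h: "continuous_on UNIV h" and \<gamma>: "\<gamma> \<in> D"
    and max: "\<And>y. - v y - a / 2 * (dist y \<gamma>)\<^sup>2 - b * d\<^sub>T y \<mu> \<le> - v \<mu> - a / 2 * (dist \<mu> \<gamma>)\<^sup>2"
  shows "\<mu> \<in> D" and "h \<mu> - v \<mu> \<le> l * (a * (e \<gamma> - e \<mu>) - (a * (\<kappa> / 2) * (dist \<mu> \<gamma>)\<^sup>2 - 2 * b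
      + 1 / 2 * a\<^sup>2 * (dist \<mu> \<gamma>)\<^sup>2 - a * (2 * b) * dist \<mu> \<gamma> - 1 / 2 * (2 * b)\<^sup>2))"
proof -
  define f where "f = (\<lambda>y. - (1 / 2) * a * (dist \<gamma> y)\<^sup>2 - (2 * b) * d\<^sub>T y \<mu> + 0)"
  define \<theta> where "\<theta> x = - (a * (\<kappa> / 2) * x\<^sup>2 - 2 * b
      + 1 / 2 * a\<^sup>2 * x\<^sup>2 - a * (2 * b) * x - 1 / 2 * (2 * b)\<^sup>2)" for x
  define g where "g = (\<lambda>y. ereal a * (\<E> y - \<E> \<gamma>) + ereal (- \<theta> (dist \<gamma> y)))"
  have "(f, g) \<in> H_ddagger \<kappa> \<E> S"
    unfolding H_ddagger_def f_def g_def \<theta>_def using a b \<gamma>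
    by (intro CollectI exI[of _ a] exI[of _ "2 * b"] exI[of _ 0] exI[of _ \<mu>] exI[of _ \<gamma>]) auto
  with super obtain X where X: "(\<lambda>n. ereal (v (X n) - f (X n))) \<longlonglongrightarrow> (INF y. ereal (v y - f y))"
    "liminf (\<lambda>n. ereal (v (X n)) - ereal l * g (X n) - ereal (h (X n))) \<ge> 0"
    unfolding viscosity_supersolution_def by blast
  have fmin: "v \<mu> - f \<mu> \<le> v y - f y" for y
  proof -
    have "0 \<le> b * d\<^sub>T y \<mu>" using b tataru_nonneg by simp
    then show ?thesis using max[of y] by (simp add: f_def dist_commute)
  qed
  have "(INF y. ereal (v y - f y)) = ereal (v \<mu> - f \<mu>)"
    by (intro antisym INF_greatest INF_lower) (auto simp: fmin)
  with X(1) have "(\<lambda>n. v (X n) - f (X n)) \<longlonglongrightarrow> v \<mu> - f \<mu>" by simp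
  then have lim: "(\<lambda>n. - (v (X n) - f (X n))) \<longlonglongrightarrow> - (v \<mu> - f \<mu>)" by (rule tendsto_minus)
  have eq: "- (v y - f y) = - v y - a / 2 * (dist y \<gamma>)\<^sup>2 - 2 * b * d\<^sub>T y \<mu>" for y
    by (simp add: f_def dist_commute)
  have conv: "(\<lambda>n. - v (X n) - a / 2 * (dist (X n) \<gamma>)\<^sup>2 - 2 * b * d\<^sub>T (X n) \<mu>)
      \<longlonglongrightarrow> - v \<mu> - a / 2 * (dist \<mu> \<gamma>)\<^sup>2"
    using lim unfolding eq by simp
  have ineq: "\<forall>\<^sub>F n in sequentially.
      \<E> (X n) \<le> ereal (e \<gamma> + (\<theta> (dist (X n) \<gamma>) + (- h (X n) - - v (X n) + \<epsilon>) / l) / a)"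
    if \<epsilon>: "\<epsilon> > 0" for \<epsilon>
  proof -
    have "ereal (- \<epsilon>) < 0" using \<epsilon> by simp
    then have "ereal (- \<epsilon>) < liminf (\<lambda>n. ereal (v (X n)) - ereal l * g (X n) - ereal (h (X n)))"
      using X(2) by (rule less_le_trans)
    from less_LiminfD[OF this] show ?thesis
    proof eventually_elim
      case (elim n)
      show ?case
      proof (cases "\<E> (X n)")
        case (real r)
        with elim have "- \<epsilon> < v (X n) - l * (a * (r - e \<gamma>) - \<theta> (dist (X n) \<gamma>)) - h (X n)"
          by (simp add: g_def energy_eq[OF \<gamma>] dist_commute)
        then have "(a * (r - e \<gamma>) - \<theta> (dist (X n) \<gamma>)) * l < v (X n) - h (X n) + \<epsilon>"
          by (simp add: algebra_simps)
        then have "a * (r - e \<gamma>) - \<theta> (dist (X n) \<gamma>) < (v (X n) - h (X n) + \<epsilon>) / l"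
          using l by (simp add: pos_less_divide_eq)
        then have "r - e \<gamma> < (\<theta> (dist (X n) \<gamma>) + (v (X n) - h (X n) + \<epsilon>) / l) / a"
          by (subst pos_less_divide_eq[OF a]) (simp add: algebra_simps)
        then show ?thesis using real by simp
      next
        case PInf
        with elim show ?thesis using a l by (simp add: g_def energy_eq[OF \<gamma>])
      next
        case MInf
        then show ?thesis using not_minfty by blast
      qed
    qed
  qed
  have \<theta>: "continuous_on UNIV \<theta>" unfolding \<theta>_def by (intro continuous_intros)
  have h': "continuous_on UNIV (\<lambda>y. - h y)" by (intro continuous_intros h)
  show "\<mu> \<in> D" by (rule viscosity_test(1)[OF a b l h' \<theta> max conv ineq])
  show "h \<mu> - v \<mu> \<le> l * (a * (e \<gamma> - e \<mu>) - (a * (\<kappa> / 2) * (dist \<mu> \<gamma>)\<^sup>2 - 2 * b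
      + 1 / 2 * a\<^sup>2 * (dist \<mu> \<gamma>)\<^sup>2 - a * (2 * b) * dist \<mu> \<gamma> - 1 / 2 * (2 * b)\<^sup>2))"
    using viscosity_test(2)[OF a b l h' \<theta> max conv ineq]
    by (simp only: \<theta>_def add_uminus_conv_diff diff_minus_eq_add uminus_add_conv_diff)
qed

section \<open>Quadrupling the variables\<close>

text \<open>The energy penalty only involves the positive part of the energy, since the energy need not be bounded
  below.\<close>

definition \<Phi> :: "('a \<Rightarrow> real) \<Rightarrow> ('a \<Rightarrow> real) \<Rightarrow> real \<Rightarrow> real \<Rightarrow> 'a \<times> 'a \<times> 'a \<times> 'a \<Rightarrow> real" where
  "\<Phi> u v a b = (\<lambda>(\<pi>, \<rho>, \<gamma>, \<mu>). u \<pi> - v \<mu>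
     - a / 2 * ((dist \<pi> \<rho>)\<^sup>2 + (dist \<rho> \<gamma>)\<^sup>2 + (dist \<gamma> \<mu>)\<^sup>2)
     - b * (max 0 (e \<rho>) + max 0 (e \<gamma>)))"

definition D4 :: "('a \<times> 'a \<times> 'a \<times> 'a) set" where
  "D4 = UNIV \<times> D \<times> D \<times> UNIV"

lemma \<Phi>_le:
  assumes "\<And>x. \<bar>u x\<bar> \<le> B" "\<And>x. \<bar>v x\<bar> \<le> B" "a \<ge> 0" "b \<ge> 0"
  shows "\<Phi> u v a b (\<pi>, \<rho>, \<gamma>, \<mu>) \<le> 2 * B - b * (max 0 (e \<rho>) + max 0 (e \<gamma>))"
proof -
  have "0 \<le> a / 2 * ((dist \<pi> \<rho>)\<^sup>2 + (dist \<rho> \<gamma>)\<^sup>2 + (dist \<gamma> \<mu>)\<^sup>2)" using assms by simp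
  then show ?thesis using assms(1)[of \<pi>] assms(2)[of \<mu>] by (simp add: \<Phi>_def)
qed

lemma \<Phi>_le_bound:
  assumes "\<And>x. \<bar>u x\<bar> \<le> B" "\<And>x. \<bar>v x\<bar> \<le> B" "a \<ge> 0" "b \<ge> 0"
  shows "\<Phi> u v a b z \<le> 2 * B"
proof -
  obtain \<pi> \<rho> \<gamma> \<mu> where z: "z = (\<pi>, \<rho>, \<gamma>, \<mu>)" by (cases z)
  have "0 \<le> b * (max 0 (e \<rho>) + max 0 (e \<gamma>))" using assms(4) by simp
  then show ?thesis unfolding z using \<Phi>_le[of u B v a b \<pi> \<rho> \<gamma> \<mu>, OF assms] by linarith
qed

lemma lsc_energy_limit:
  assumes "X \<longlonglongrightarrow> y" "\<And>n. \<E> (X n) \<le> c" shows "\<E> y \<le> c"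
  using closed_sequentially[OF lsc_closed_sublevel[OF lsc], of X c y] assms by simp

lemma energy_part_eventually:
  assumes X: "X \<longlonglongrightarrow> y" "\<And>n. X n \<in> D" and y: "y \<in> D" and \<eta>: "\<eta> > 0"
  shows "\<forall>\<^sub>F n in sequentially. max 0 (e y) - \<eta> \<le> max 0 (e (X n))"
proof -
  have "\<forall>\<^sub>F z in nhds y. ereal (e y - \<eta>) < \<E> z"
    using \<eta> energy_eq[OF y] by (intro lsc_eventually_less lsc) auto
  then have "\<forall>\<^sub>F n in sequentially. ereal (e y - \<eta>) < \<E> (X n)"
    using X(1) by (auto simp: filterlim_iff)
  then show ?thesis
  proof eventually_elim
    case (elim n)
    then have "e y - \<eta> < e (X n)" using energy_eq[OF X(2)] by simp
    then show ?case using \<eta> by linarith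
  qed
qed

text \<open>A lower bound on \<open>\<Phi>\<close> bounds the energies of the auxiliary points, because \<open>b > 0\<close> and \<open>u\<close>, \<open>v\<close> are bounded;
  hence their limits stay in the domain.\<close>

lemma \<Phi>_upper_semicontinuous:
  assumes u: "usc (\<lambda>x. ereal (u x))" "\<And>x. \<bar>u x\<bar> \<le> B" and v: "lsc (\<lambda>x. ereal (v x))" "\<And>x. \<bar>v x\<bar> \<le> B"
    and a: "a \<ge> 0" and b: "b > 0"
    and X: "X \<longlonglongrightarrow> z" "\<And>n. X n \<in> D4 \<and> c \<le> \<Phi> u v a b (X n)"
  shows "z \<in> D4 \<and> c \<le> \<Phi> u v a b z"
proof -
  define p q r s where "p = (\<lambda>n. fst (X n))" and "q = (\<lambda>n. fst (snd (X n)))"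
    and "r = (\<lambda>n. fst (snd (snd (X n))))" and "s = (\<lambda>n. snd (snd (snd (X n))))"
  have Xn: "X n = (p n, q n, r n, s n)" for n by (simp add: p_def q_def r_def s_def)
  obtain \<pi> \<rho> \<gamma> \<mu> where z: "z = (\<pi>, \<rho>, \<gamma>, \<mu>)" by (cases z)
  have lim: "p \<longlonglongrightarrow> \<pi>" "q \<longlonglongrightarrow> \<rho>" "r \<longlonglongrightarrow> \<gamma>" "s \<longlonglongrightarrow> \<mu>"
    using tendsto_fst[OF X(1)] tendsto_fst[OF tendsto_snd[OF X(1)]]
      tendsto_fst[OF tendsto_snd[OF tendsto_snd[OF X(1)]]]
      tendsto_snd[OF tendsto_snd[OF tendsto_snd[OF X(1)]]]
    by (simp_all add: z p_def q_def r_def s_def)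
  have qr: "q n \<in> D" "r n \<in> D" for n using X(2)[of n] by (auto simp: Xn D4_def)
  have bd: "max 0 (e (q n)) + max 0 (e (r n)) \<le> (2 * B - c) / b" for n
    using \<Phi>_le[of u B v a b "p n" "q n" "r n" "s n", OF u(2) v(2) a less_imp_le[OF b]] X(2)[of n] b
    by (simp add: Xn pos_le_divide_eq mult.commute)
  have "e (q n) \<le> (2 * B - c) / b" "e (r n) \<le> (2 * B - c) / b" for n
    using bd[of n] by linarith+
  then have "\<E> (q n) \<le> ereal ((2 * B - c) / b)" "\<E> (r n) \<le> ereal ((2 * B - c) / b)" for n
    using energy_eq qr by auto
  then have "\<E> \<rho> \<le> ereal ((2 * B - c) / b)" "\<E> \<gamma> \<le> ereal ((2 * B - c) / b)"
    using lsc_energy_limit lim by blast+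
  then have D: "\<rho> \<in> D" "\<gamma> \<in> D" by (auto intro: D_I)
  have "c \<le> \<Phi> u v a b z"
  proof (rule field_le_epsilon)
    fix \<epsilon> :: real assume \<epsilon>: "\<epsilon> > 0"
    define \<eta> where "\<eta> = \<epsilon> / (3 + 2 * b)"
    have "\<eta> > 0" using \<epsilon> b by (simp add: \<eta>_def)
    moreover have "\<eta> * (3 + 2 * b) = \<epsilon>" using b by (simp add: \<eta>_def)
    ultimately have \<eta>: "\<eta> > 0" "3 * \<eta> + b * (2 * \<eta>) = \<epsilon>" by (simp_all add: algebra_simps)
    have "\<forall>\<^sub>F x in nhds \<pi>. ereal (- u \<pi> - \<eta>) < - ereal (u x)"
      by (rule lsc_eventually_less[OF lsc_uminus_usc[OF u(1)]]) (simp add: \<eta>)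
    then have 1: "\<forall>\<^sub>F n in sequentially. u (p n) < u \<pi> + \<eta>"
      using lim(1) by (auto simp: filterlim_iff elim!: allE[of _ "\<lambda>x. ereal (- u \<pi> - \<eta>) < - ereal (u x)"] elim: eventually_mono)
    have "\<forall>\<^sub>F x in nhds \<mu>. ereal (v \<mu> - \<eta>) < ereal (v x)"
      by (rule lsc_eventually_less[OF v(1)]) (simp add: \<eta>)
    then have 2: "\<forall>\<^sub>F n in sequentially. v \<mu> - \<eta> < v (s n)"
      using lim(4) by (auto simp: filterlim_iff)
    have "(\<lambda>n. - (a / 2 * ((dist (p n) (q n))\<^sup>2 + (dist (q n) (r n))\<^sup>2 + (dist (r n) (s n))\<^sup>2)))
        \<longlonglongrightarrow> - (a / 2 * ((dist \<pi> \<rho>)\<^sup>2 + (dist \<rho> \<gamma>)\<^sup>2 + (dist \<gamma> \<mu>)\<^sup>2))"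
      by (intro tendsto_intros lim)
    then have 3: "\<forall>\<^sub>F n in sequentially.
        - (a / 2 * ((dist (p n) (q n))\<^sup>2 + (dist (q n) (r n))\<^sup>2 + (dist (r n) (s n))\<^sup>2))
        < - (a / 2 * ((dist \<pi> \<rho>)\<^sup>2 + (dist \<rho> \<gamma>)\<^sup>2 + (dist \<gamma> \<mu>)\<^sup>2)) + \<eta>"
      by (rule order_tendstoD(2)) (simp add: \<eta>)
    have "\<forall>\<^sub>F n in sequentially. c \<le> \<Phi> u v a b z + \<epsilon>"
      using 1 2 3 energy_part_eventually[OF lim(2) qr(1) D(1) \<eta>(1)]
        energy_part_eventually[OF lim(3) qr(2) D(2) \<eta>(1)]
    proof eventually_elim
      case (elim n)
      have "b * (max 0 (e \<rho>) + max 0 (e \<gamma>) - 2 * \<eta>) \<le> b * (max 0 (e (q n)) + max 0 (e (r n)))"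
        using elim b by (intro mult_left_mono) auto
      then have "b * (max 0 (e \<rho>) + max 0 (e \<gamma>)) - b * (2 * \<eta>) \<le> b * (max 0 (e (q n)) + max 0 (e (r n)))"
        by (simp add: right_diff_distrib)
      moreover have "c \<le> \<Phi> u v a b (p n, q n, r n, s n)" using X(2)[of n] by (simp add: Xn)
      ultimately show ?case using elim(1,2,3) \<eta>(2) unfolding z \<Phi>_def prod.case by linarith
    qed
    then show "c \<le> \<Phi> u v a b z + \<epsilon>" by (simp add: eventually_const)
  qed
  with D show ?thesis by (simp add: z D4_def)
qed

lemma penalized_maximizer:
  assumes u: "usc (\<lambda>x. ereal (u x))" "\<And>x. \<bar>u x\<bar> \<le> B" and v: "lsc (\<lambda>x. ereal (v x))" "\<And>x. \<bar>v x\<bar> \<le> B"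
    and a: "a \<ge> 0" and b: "b > 0" and z0: "z0 \<in> D4"
  obtains \<pi> \<rho> \<gamma> \<mu> where "\<rho> \<in> D" "\<gamma> \<in> D" "\<Phi> u v a b z0 \<le> \<Phi> u v a b (\<pi>, \<rho>, \<gamma>, \<mu>)"
    "\<And>\<pi>' \<rho>' \<gamma>' \<mu>'. \<rho>' \<in> D \<Longrightarrow> \<gamma>' \<in> D \<Longrightarrow> \<Phi> u v a b (\<pi>', \<rho>', \<gamma>', \<mu>') \<le> \<Phi> u v a b (\<pi>, \<rho>, \<gamma>, \<mu>)
      + b * (d\<^sub>T \<pi>' \<pi> + d\<^sub>T \<rho>' \<rho> + d\<^sub>T \<gamma>' \<gamma> + d\<^sub>T \<mu>' \<mu>)"
proof -
  define q where "q z z' = d\<^sub>T (fst z) (fst z') + d\<^sub>T (fst (snd z)) (fst (snd z'))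
      + d\<^sub>T (fst (snd (snd z))) (fst (snd (snd z'))) + d\<^sub>T (snd (snd (snd z))) (snd (snd (snd z')))"
    for z z' :: "'a \<times> 'a \<times> 'a \<times> 'a"
  obtain z where z: "z \<in> D4" "\<Phi> u v a b z0 \<le> \<Phi> u v a b z"
    "\<And>z'. z' \<in> D4 \<Longrightarrow> \<Phi> u v a b z' \<le> \<Phi> u v a b z + b * q z' z"
  proof (rule ekeland_quasimetric[of q D4 "\<Phi> u v a b" z0 b])
    show "q x y \<ge> 0" for x y unfolding q_def by (intro add_nonneg_nonneg tataru_nonneg)
    show "q x x = 0" for x by (simp add: q_def)
    show "q x z \<le> q x y + q y z" for x y z
      using tataru_triangle[of "fst x" "fst z" "fst y"]
        tataru_triangle[of "fst (snd x)" "fst (snd z)" "fst (snd y)"]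
        tataru_triangle[of "fst (snd (snd x))" "fst (snd (snd z))" "fst (snd (snd y))"]
        tataru_triangle[of "snd (snd (snd x))" "snd (snd (snd z))" "snd (snd (snd y))"]
      unfolding q_def by linarith
    show "continuous_on UNIV (\<lambda>x. q x y)" for y
      unfolding q_def
      by (intro continuous_on_add; rule continuous_on_compose2[OF tataru_continuous])
        (auto intro!: continuous_intros)
    show "\<exists>y. X \<longlonglongrightarrow> y" if X: "\<And>n. q (X (Suc n)) (X n) \<le> (1/2) ^ n" for X :: "nat \<Rightarrow> 'a \<times> 'a \<times> 'a \<times> 'a"
    proof -
      have conv: "\<exists>y. (\<lambda>n. \<psi> (X n)) \<longlonglongrightarrow> y" if \<psi>: "\<And>z z'. d\<^sub>T (\<psi> z) (\<psi> z') \<le> q z z'" for \<psi>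
      proof -
        have "Cauchy (\<lambda>n. \<psi> (X n))"
          by (rule tataru_complete) (rule order_trans[OF \<psi> X])
        then show ?thesis by (simp add: Cauchy_convergent_iff convergent_def)
      qed
      have nn: "0 \<le> d\<^sub>T (fst z) (fst z')" "0 \<le> d\<^sub>T (fst (snd z)) (fst (snd z'))"
        "0 \<le> d\<^sub>T (fst (snd (snd z))) (fst (snd (snd z')))"
        "0 \<le> d\<^sub>T (snd (snd (snd z))) (snd (snd (snd z')))" for z z' :: "'a \<times> 'a \<times> 'a \<times> 'a"
        by (rule tataru_nonneg)+
      have "\<exists>y. (\<lambda>n. fst (X n)) \<longlonglongrightarrow> y" "\<exists>y. (\<lambda>n. fst (snd (X n))) \<longlonglongrightarrow> y"
        "\<exists>y. (\<lambda>n. fst (snd (snd (X n)))) \<longlonglongrightarrow> y" "\<exists>y. (\<lambda>n. snd (snd (snd (X n)))) \<longlonglongrightarrow> y"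
        using nn by (intro conv; simp add: q_def add.assoc)+
      then obtain y1 y2 y3 y4 where "(\<lambda>n. fst (X n)) \<longlonglongrightarrow> y1" "(\<lambda>n. fst (snd (X n))) \<longlonglongrightarrow> y2"
        "(\<lambda>n. fst (snd (snd (X n)))) \<longlonglongrightarrow> y3" "(\<lambda>n. snd (snd (snd (X n)))) \<longlonglongrightarrow> y4" by blast
      then have "(\<lambda>n. (fst (X n), fst (snd (X n)), fst (snd (snd (X n))), snd (snd (snd (X n)))))
          \<longlonglongrightarrow> (y1, y2, y3, y4)" by (intro tendsto_Pair)
      then show ?thesis by auto
    qed
    show "y \<in> D4 \<and> c \<le> \<Phi> u v a b y" if "X \<longlonglongrightarrow> y" "\<And>n. X n \<in> D4 \<and> c \<le> \<Phi> u v a b (X n)" for X y c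
      using \<Phi>_upper_semicontinuous[OF u v a b that] .
    show "bdd_above (\<Phi> u v a b ` D4)"
      using \<Phi>_le_bound[of u B v a b, OF u(2) v(2) a less_imp_le[OF b]] by (intro bdd_aboveI2)
  qed (use z0 b in auto)
  obtain \<pi> \<rho> \<gamma> \<mu> where zz: "z = (\<pi>, \<rho>, \<gamma>, \<mu>)" by (cases z)
  show ?thesis
  proof (rule that[of \<rho> \<gamma> \<pi> \<mu>])
    show "\<rho> \<in> D" "\<gamma> \<in> D" "\<Phi> u v a b z0 \<le> \<Phi> u v a b (\<pi>, \<rho>, \<gamma>, \<mu>)"
      using z(1,2) by (auto simp: zz D4_def)
    fix \<pi>' \<rho>' \<gamma>' \<mu>' assume "\<rho>' \<in> D" "\<gamma>' \<in> D"
    then have "(\<pi>', \<rho>', \<gamma>', \<mu>') \<in> D4" by (simp add: D4_def)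
    from z(3)[OF this] show "\<Phi> u v a b (\<pi>', \<rho>', \<gamma>', \<mu>') \<le> \<Phi> u v a b (\<pi>, \<rho>, \<gamma>, \<mu>)
      + b * (d\<^sub>T \<pi>' \<pi> + d\<^sub>T \<rho>' \<rho> + d\<^sub>T \<gamma>' \<gamma> + d\<^sub>T \<mu>' \<mu>)"
      by (simp add: zz q_def)
  qed
qed

text \<open>Restricting the auxiliary points to the domain does not lower the supremum below that of \<open>u - v\<close>, as
  the domain is dense.\<close>

lemma le_\<Phi>_sup:
  assumes dense: "closure D = UNIV" and u: "\<And>x. \<bar>u x\<bar> \<le> B" and v: "\<And>x. \<bar>v x\<bar> \<le> B" and a: "a \<ge> 0"
  shows "u \<pi> - v \<pi> \<le> (SUP z\<in>D4. \<Phi> u v a 0 z)"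
proof -
  obtain X where X: "\<And>n. X n \<in> D" "X \<longlonglongrightarrow> \<pi>"
    using dense closure_sequential[of \<pi> D] by auto
  have bdd: "bdd_above (\<Phi> u v a 0 ` D4)"
    using \<Phi>_le_bound[of u B v a 0, OF u v a] by (intro bdd_aboveI2) simp
  have "(\<lambda>n. u \<pi> - v \<pi> - a * (dist \<pi> (X n))\<^sup>2) \<longlonglongrightarrow> u \<pi> - v \<pi> - a * (dist \<pi> \<pi>)\<^sup>2"
    by (intro tendsto_intros X)
  then have "(\<lambda>n. u \<pi> - v \<pi> - a * (dist \<pi> (X n))\<^sup>2) \<longlonglongrightarrow> u \<pi> - v \<pi>" by simp
  then show ?thesis
  proof (rule tendsto_upperbound)
    have "u \<pi> - v \<pi> - a * (dist \<pi> (X n))\<^sup>2 \<le> (SUP z\<in>D4. \<Phi> u v a 0 z)" for n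
    proof -
      have "\<Phi> u v a 0 (\<pi>, X n, X n, \<pi>) \<le> (SUP z\<in>D4. \<Phi> u v a 0 z)"
        by (rule cSUP_upper[OF _ bdd]) (simp add: D4_def X)
      then show ?thesis by (simp add: \<Phi>_def dist_commute)
    qed
    then show "\<forall>\<^sub>F n in sequentially. u \<pi> - v \<pi> - a * (dist \<pi> (X n))\<^sup>2 \<le> (SUP z\<in>D4. \<Phi> u v a 0 z)"
      by simp
  qed simp
qed

text \<open>The supremum decreases in \<open>a\<close> and is bounded below, so along powers of two its increments tend to 0. At a near
  maximum for such an \<open>a\<close> the quantity \<open>a d\<^sup>2\<close> is small, not just bounded.\<close>

lemma \<Phi>_sup_gap:
  assumes dense: "closure D = UNIV" and u: "\<And>x. \<bar>u x\<bar> \<le> B" and v: "\<And>x. \<bar>v x\<bar> \<le> B" and \<eta>: "\<eta> > 0"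
  obtains a where "a \<ge> 1" "(SUP z\<in>D4. \<Phi> u v (a / 2) 0 z) < (SUP z\<in>D4. \<Phi> u v a 0 z) + \<eta>"
proof -
  define M where "M n = (SUP z\<in>D4. \<Phi> u v (2 ^ n) 0 z)" for n :: nat
  have ne: "D4 \<noteq> {}" using dom_ne by (auto simp: D4_def)
  have bdd: "bdd_above (\<Phi> u v (2 ^ n) 0 ` D4)" for n :: nat
    using \<Phi>_le_bound[of u B v "2 ^ n" 0, OF u v] by (intro bdd_aboveI2) simp
  have "decseq M"
  proof (rule decseq_SucI)
    fix n
    show "M (Suc n) \<le> M n" unfolding M_def
    proof (rule cSUP_mono[OF ne bdd])
      fix z assume z: "z \<in> D4"
      obtain \<pi> \<rho> \<gamma> \<mu> where zz: "z = (\<pi>, \<rho>, \<gamma>, \<mu>)" by (cases z)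
      have "2 ^ n / 2 * ((dist \<pi> \<rho>)\<^sup>2 + (dist \<rho> \<gamma>)\<^sup>2 + (dist \<gamma> \<mu>)\<^sup>2)
          \<le> 2 ^ Suc n / 2 * ((dist \<pi> \<rho>)\<^sup>2 + (dist \<rho> \<gamma>)\<^sup>2 + (dist \<gamma> \<mu>)\<^sup>2)"
        by (intro mult_right_mono) auto
      then have "\<Phi> u v (2 ^ Suc n) 0 z \<le> \<Phi> u v (2 ^ n) 0 z" unfolding \<Phi>_def zz prod.case by linarith
      with z show "\<exists>m\<in>D4. \<Phi> u v (2 ^ Suc n) 0 z \<le> \<Phi> u v (2 ^ n) 0 m" by blast
    qed
  qed
  moreover have "- 2 * B \<le> M n" for n
  proof -
    have "u x - v x \<le> M n" for x
      unfolding M_def by (rule le_\<Phi>_sup[OF dense u v]) simp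
    from this[of undefined] show ?thesis using u[of undefined] v[of undefined] by linarith
  qed
  ultimately obtain L where L: "M \<longlonglongrightarrow> L"
    using decseq_convergent[of M "- 2 * B"] by metis
  then have "(\<lambda>n. M n - M (Suc n)) \<longlonglongrightarrow> L - L" by (intro tendsto_diff LIMSEQ_Suc)
  then have "\<forall>\<^sub>F n in sequentially. M n - M (Suc n) < \<eta>"
    by (rule order_tendstoD(2)) (simp add: \<eta>)
  then obtain n where "M n - M (Suc n) < \<eta>" unfolding eventually_sequentially by blast
  then show ?thesis
    by (intro that[of "2 ^ Suc n"]) (simp_all add: M_def one_le_power del: power_Suc, simp)
qed

end

text \<open>Here \<open>x, y, z\<close> are the consecutive distances along \<open>\<pi>, \<rho>, \<gamma>, \<mu>\<close>. The conditions \<open>F1\<close> and \<open>F2\<close> come from the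
  flow, \<open>G1\<close> and \<open>G2\<close> from geodesics. The bound on \<open>U\<close> from below turns \<open>sub\<close> into an upper bound for
  \<open>a (E\<^sub>\<pi> - E\<^sub>\<rho>)\<close>, and then \<open>F1\<close> gives one for \<open>a (E\<^sub>\<rho> - E\<^sub>\<gamma>)\<close>. So the errors in \<open>G1\<close> and \<open>G2\<close> are at
  most \<open>b K\<close>, where \<open>K\<close> depends on \<open>a\<close> but not on \<open>b\<close>.\<close>

lemma hamiltonian_gap:
  fixes a b l \<kappa> B \<eta> x y z E\<^sub>\<pi> E\<^sub>\<rho> E\<^sub>\<gamma> E\<^sub>\<mu> U V :: real
  defines "K \<equiv> 2 * B / l + 19 * a * \<bar>\<kappa>\<bar> + 8 + 6 * a + 5 * a\<^sup>2"
  assumes a: "a \<ge> 1" and b: "0 < b" "b \<le> 1" and l: "l > 0" and B: "B \<ge> 0"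
    and xyz: "0 \<le> x" "x \<le> 3" "0 \<le> y" "y \<le> 3" "0 \<le> z" "z \<le> 3"
    and Q: "a * (x\<^sup>2 + y\<^sup>2 + z\<^sup>2) \<le> 8 * \<eta>"
    and sub: "U \<le> l * (a * (E\<^sub>\<rho> - E\<^sub>\<pi>) + (- a * (\<kappa> / 2) * x\<^sup>2 + 2 * b
      + 1 / 2 * a\<^sup>2 * x\<^sup>2 + a * (2 * b) * x + 1 / 2 * (2 * b)\<^sup>2))"
    and super: "- V \<le> l * (a * (E\<^sub>\<gamma> - E\<^sub>\<mu>) - (a * (\<kappa> / 2) * z\<^sup>2 - 2 * b
      + 1 / 2 * a\<^sup>2 * z\<^sup>2 - a * (2 * b) * z - 1 / 2 * (2 * b)\<^sup>2))"
    and U: "- 2 * B \<le> U"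
    and F1: "a * (E\<^sub>\<rho> - E\<^sub>\<pi>) \<le> a * (E\<^sub>\<gamma> - E\<^sub>\<rho>) - a * \<kappa> / 2 * (x\<^sup>2 + y\<^sup>2) + b"
    and F2: "a * (E\<^sub>\<gamma> - E\<^sub>\<mu>) \<le> a * (E\<^sub>\<rho> - E\<^sub>\<gamma>) - a * \<kappa> / 2 * (y\<^sup>2 + z\<^sup>2) + b"
    and G1: "a * x\<^sup>2 \<le> a * x * y + b * (x + max 0 (E\<^sub>\<pi> - E\<^sub>\<rho> + \<bar>\<kappa>\<bar> / 2 * x\<^sup>2))"
    and G2: "a * y\<^sup>2 \<le> a * y * z + b * (y + max 0 (E\<^sub>\<rho> - E\<^sub>\<gamma> + \<bar>\<kappa>\<bar> / 2 * y\<^sup>2))"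
  shows "U - V \<le> l * (8 * \<bar>\<kappa>\<bar> * \<eta> + b * (10 + 12 * a + 2 * a * K))"
proof -
  have sq: "x\<^sup>2 \<le> 9" "y\<^sup>2 \<le> 9" "0 \<le> x\<^sup>2" "0 \<le> y\<^sup>2" "0 \<le> z\<^sup>2"
    using power_mono[OF xyz(2,1), of 2] power_mono[OF xyz(4,3), of 2] by auto
  have ab: "a * b \<le> a" "a * b * x \<le> 3 * a" "a * b * z \<le> 3 * (a * b)" "a * b * x \<le> 3 * (a * b)"
    "0 \<le> a * b" "b\<^sup>2 \<le> b" "b\<^sup>2 \<le> 1"
  proof -
    show "a * b \<le> a" using a b by simp
    then have "a * b * x \<le> a * 3" using a b xyz by (intro mult_mono) auto
    then show "a * b * x \<le> 3 * a" by simp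
    have "a * b * z \<le> a * b * 3" "a * b * x \<le> a * b * 3"
      using a b xyz by (auto intro!: mult_left_mono)
    then show "a * b * z \<le> 3 * (a * b)" "a * b * x \<le> 3 * (a * b)" by simp_all
    show "0 \<le> a * b" using a b by simp
    show "b\<^sup>2 \<le> b" using b by (simp add: power2_eq_square)
    then show "b\<^sup>2 \<le> 1" using b by simp
  qed
  have kx: "- (\<kappa> * w) \<le> \<bar>\<kappa>\<bar> * w" if "w \<ge> 0" for w
    using mult_right_mono[of "- \<kappa>" "\<bar>\<kappa>\<bar>" w] that by simp
  have akx: "- (a * (\<kappa> * w)) \<le> a * (\<bar>\<kappa>\<bar> * w)" if "w \<ge> 0" for w
    using mult_left_mono[OF kx[OF that], of a] a by simp
  have ak9: "a * (\<bar>\<kappa>\<bar> * w) \<le> 9 * (a * \<bar>\<kappa>\<bar>)" if "w \<le> 9" for w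
  proof -
    have "a * (\<bar>\<kappa>\<bar> * w) \<le> a * (\<bar>\<kappa>\<bar> * 9)" using that a by (intro mult_left_mono) auto
    then show ?thesis by simp
  qed
  have k1: "\<bar>\<kappa>\<bar> \<le> a * \<bar>\<kappa>\<bar>" using mult_right_mono[OF a, of "\<bar>\<kappa>\<bar>"] by simp
  have k9: "\<bar>\<kappa>\<bar> / 2 * w \<le> 5 * (a * \<bar>\<kappa>\<bar>)" if "0 \<le> w" "w \<le> 9" for w
  proof -
    have "\<bar>\<kappa>\<bar> / 2 * w \<le> \<bar>\<kappa>\<bar> / 2 * 9" using that by (intro mult_left_mono) auto
    then show ?thesis using k1 by linarith
  qed
  have a2x: "a\<^sup>2 * x\<^sup>2 \<le> 9 * a\<^sup>2" using mult_left_mono[OF sq(1), of "a\<^sup>2"] by simp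
  have ak0: "0 \<le> a * \<bar>\<kappa>\<bar>" using a by simp
  define K0 where "K0 = 2 * B / l + 5 * (a * \<bar>\<kappa>\<bar>) + 4 + 6 * a + 5 * a\<^sup>2"
  \<comment> \<open>The coefficients are crude: they use that \<open>x, y \<le> 3\<close> and \<open>b \<le> 1 \<le> a\<close>.\<close>
  have K0: "K0 \<ge> 0" using a l B by (simp add: K0_def)
  have K: "K = K0 + 14 * (a * \<bar>\<kappa>\<bar>) + 4" by (simp add: K_def K0_def)
  have "U / l \<le> a * (E\<^sub>\<rho> - E\<^sub>\<pi>) + (- a * (\<kappa> / 2) * x\<^sup>2 + 2 * b
      + 1 / 2 * a\<^sup>2 * x\<^sup>2 + a * (2 * b) * x + 1 / 2 * (2 * b)\<^sup>2)"
    using sub l by (simp add: pos_divide_le_eq mult.commute)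
  moreover have "- 2 * B / l \<le> U / l" using U l by (intro divide_right_mono) auto
  ultimately have "- (a * (E\<^sub>\<rho> - E\<^sub>\<pi>)) \<le> 2 * B / l + (- (a * (\<kappa> * x\<^sup>2))) / 2 + 2 * b
      + (a\<^sup>2 * x\<^sup>2) / 2 + 2 * (a * b * x) + 2 * b\<^sup>2"
    by (simp add: power2_eq_square algebra_simps)
  also have "\<dots> \<le> K0"
    using akx[OF sq(3)] ak9[OF sq(1)] a2x ab a b ak0 zero_le_power2[of a] unfolding K0_def by linarith
  finally have aE1: "a * (E\<^sub>\<pi> - E\<^sub>\<rho>) \<le> K0" by (simp add: algebra_simps)
  have small: "d \<le> c" if "a * d \<le> c" "c \<ge> 0" for c d
  proof (cases "d \<le> 0")
    case False
    then have "1 * d \<le> a * d" using a by (intro mult_right_mono) auto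
    with that show ?thesis by simp
  qed (use that in simp)
  have E1: "E\<^sub>\<pi> - E\<^sub>\<rho> \<le> K0" using small[OF aE1 K0] .
  have "a * (E\<^sub>\<rho> - E\<^sub>\<gamma>) \<le> a * (E\<^sub>\<pi> - E\<^sub>\<rho>) + (- (a * (\<kappa> * x\<^sup>2))) / 2 + (- (a * (\<kappa> * y\<^sup>2))) / 2 + b"
    using F1 by (simp add: field_simps)
  also have "\<dots> \<le> K0 + 9 * (a * \<bar>\<kappa>\<bar>) + 1"
    using aE1 order_trans[OF akx[OF sq(3)] ak9[OF sq(1)]] order_trans[OF akx[OF sq(4)] ak9[OF sq(2)]] b
    by linarith
  finally have E2: "E\<^sub>\<rho> - E\<^sub>\<gamma> \<le> K0 + 9 * (a * \<bar>\<kappa>\<bar>) + 1"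
    by (rule small) (use K0 ak0 in linarith)
  have "x + max 0 (E\<^sub>\<pi> - E\<^sub>\<rho> + \<bar>\<kappa>\<bar> / 2 * x\<^sup>2) \<le> K"
    using E1 k9[OF sq(3,1)] xyz K0 ak0 unfolding K by linarith
  then have b1: "b * (x + max 0 (E\<^sub>\<pi> - E\<^sub>\<rho> + \<bar>\<kappa>\<bar> / 2 * x\<^sup>2)) \<le> b * K"
    using b by (intro mult_left_mono) auto
  have "y + max 0 (E\<^sub>\<rho> - E\<^sub>\<gamma> + \<bar>\<kappa>\<bar> / 2 * y\<^sup>2) \<le> K"
    using E2 k9[OF sq(4,2)] xyz K0 ak0 unfolding K by linarith
  then have b2: "b * (y + max 0 (E\<^sub>\<rho> - E\<^sub>\<gamma> + \<bar>\<kappa>\<bar> / 2 * y\<^sup>2)) \<le> b * K"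
    using b by (intro mult_left_mono) auto
  have young: "2 * (a * s * t) \<le> a * s\<^sup>2 + a * t\<^sup>2" for s t
  proof -
    have "0 \<le> a * (s - t)\<^sup>2" using a by simp
    then show ?thesis by (simp add: power2_eq_square algebra_simps)
  qed
  have "a * x\<^sup>2 - a * z\<^sup>2 \<le> 4 * (b * K)"
    using order_trans[OF G1 add_left_mono[OF b1]] order_trans[OF G2 add_left_mono[OF b2]]
      young[of x y] young[of y z] by linarith
  then have "a / 2 * (a * x\<^sup>2 - a * z\<^sup>2) \<le> a / 2 * (4 * (b * K))"
    using a by (intro mult_left_mono) auto
  then have diff: "a\<^sup>2 * x\<^sup>2 / 2 - a\<^sup>2 * z\<^sup>2 / 2 \<le> 2 * (a * b * K)"
    by (simp add: power2_eq_square algebra_simps)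
  have "- (a * (\<kappa> * (x\<^sup>2 + y\<^sup>2 + z\<^sup>2))) \<le> \<bar>\<kappa>\<bar> * (a * (x\<^sup>2 + y\<^sup>2 + z\<^sup>2))"
    using akx[of "x\<^sup>2 + y\<^sup>2 + z\<^sup>2"] by (simp add: mult.left_commute)
  also have "\<dots> \<le> \<bar>\<kappa>\<bar> * (8 * \<eta>)" using Q by (intro mult_left_mono) auto
  finally have kQ: "- (a * (\<kappa> * (x\<^sup>2 + y\<^sup>2 + z\<^sup>2))) \<le> 8 * (\<bar>\<kappa>\<bar> * \<eta>)" by simp
  have energies: "a * (E\<^sub>\<rho> - E\<^sub>\<pi>) + a * (E\<^sub>\<gamma> - E\<^sub>\<mu>) \<le> - (a * \<kappa> / 2 * (x\<^sup>2 + 2 * y\<^sup>2 + z\<^sup>2)) + 2 * b"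
    using F1 F2 by (simp add: algebra_simps)
  have "U - V \<le> l * ((a * (E\<^sub>\<rho> - E\<^sub>\<pi>) + a * (E\<^sub>\<gamma> - E\<^sub>\<mu>)) - a * \<kappa> / 2 * (x\<^sup>2 + z\<^sup>2) + 4 * b
      + (a\<^sup>2 * x\<^sup>2 / 2 - a\<^sup>2 * z\<^sup>2 / 2) + 2 * (a * b * x) + 2 * (a * b * z) + 4 * b\<^sup>2)"
    using sub super by (simp add: power2_eq_square field_simps)
  also have "\<dots> \<le> l * (- (a * \<kappa> / 2 * (x\<^sup>2 + 2 * y\<^sup>2 + z\<^sup>2)) + 2 * b - a * \<kappa> / 2 * (x\<^sup>2 + z\<^sup>2) + 4 * b
      + 2 * (a * b * K) + 6 * (a * b) + 6 * (a * b) + 4 * b)"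
    using energies diff ab l by (intro mult_left_mono) linarith+
  also have "\<dots> = l * (- (a * (\<kappa> * (x\<^sup>2 + y\<^sup>2 + z\<^sup>2))) + b * (10 + 12 * a + 2 * a * K))"
    by (simp add: field_simps)
  also have "\<dots> \<le> l * (8 * \<bar>\<kappa>\<bar> * \<eta> + b * (10 + 12 * a + 2 * a * K))"
    using kQ l by (intro mult_left_mono) auto
  finally show ?thesis .
qed

section \<open>The comparison principle\<close>

text \<open>Order of the choices: \<open>\<eta>\<close> from the modulus of continuity of \<open>h1\<close>, then \<open>a\<close> from \<open>\<eta>\<close>, then a near maximum
  \<open>z1\<close> of the unpenalized function, and \<open>b\<close> last, so small that it neither spoils the value at \<open>z1\<close> nor
  contributes to the final estimate, in which its coefficient depends on \<open>a\<close>.\<close>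

lemma (in evi_flow) comparison:
  assumes geo: "\<And>\<rho> \<pi> :: 'a. \<exists>\<zeta>. geodesic \<zeta> \<rho> \<pi>" and dense: "closure D = UNIV" and l: "l > 0"
    and h1: "uniformly_continuous_on UNIV h1" and h2: "continuous_on UNIV h2"
    and bounds: "\<And>x. \<bar>u x\<bar> \<le> B" "\<And>x. \<bar>v x\<bar> \<le> B" "\<And>x. \<bar>h1 x\<bar> \<le> B"
    and sub: "viscosity_subsolution (H_dagger \<kappa> \<E> S) l h1 u"
    and super: "viscosity_supersolution (H_ddagger \<kappa> \<E> S) l h2 v"
    and H: "\<And>x. h1 x - h2 x \<le> H"
  shows "u p - v p \<le> H"
proof (rule field_le_epsilon)
  fix \<epsilon> :: real assume \<epsilon>: "\<epsilon> > 0"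
  have B: "B \<ge> 0" using bounds(1)[of p] by linarith
  have usc: "usc (\<lambda>x. ereal (u x))" and lsc_v: "lsc (\<lambda>x. ereal (v x))"
    using sub super by (auto simp: viscosity_subsolution_def viscosity_supersolution_def)
  have h1c: "continuous_on UNIV h1" by (rule uniformly_continuous_imp_continuous[OF h1])
  obtain \<delta> where \<delta>: "\<delta> > 0" "\<And>x y. dist x y < \<delta> \<Longrightarrow> dist (h1 x) (h1 y) < \<epsilon> / 4"
  proof (rule uniformly_continuous_onE[OF h1, of "\<epsilon> / 4"])
    show "0 < \<epsilon> / 4" using \<epsilon> by simp
  qed simp
  \<comment> \<open>The bound by \<open>\<delta>\<^sup>2 / 32\<close> makes \<open>d(\<pi>, \<mu>) < \<delta>\<close> at the maximum: its square is at most \<open>3 Q \<le> 24 \<eta>\<close>, where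
      \<open>Q\<close> is the sum of the three squared distances and \<open>a Q \<le> 8 \<eta>\<close>.\<close>
  define \<eta> where "\<eta> = min (min 1 (\<epsilon> / 4)) (min (\<delta>\<^sup>2 / 32) (\<epsilon> / (32 * l * (\<bar>\<kappa>\<bar> + 1))))"
  have \<eta>: "\<eta> > 0" using \<epsilon> \<delta>(1) l by (simp add: \<eta>_def)
  have \<eta>_le: "\<eta> \<le> 1" "\<eta> \<le> \<epsilon> / 4" "\<eta> \<le> \<delta>\<^sup>2 / 32" "\<eta> \<le> \<epsilon> / (32 * l * (\<bar>\<kappa>\<bar> + 1))"
    unfolding \<eta>_def
    by (rule min.coboundedI1 min.coboundedI2, rule min.cobounded1 min.cobounded2)+
  have \<eta>1: "24 * \<eta> < \<delta>\<^sup>2" using \<eta>_le(3) \<eta> by simp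
  have \<eta>2: "l * (8 * \<bar>\<kappa>\<bar> * \<eta>) \<le> \<epsilon> / 4"
  proof -
    have "\<eta> * (32 * l * (\<bar>\<kappa>\<bar> + 1)) \<le> \<epsilon>" using l \<eta>_le(4) by (simp add: pos_le_divide_eq)
    moreover have "0 \<le> l * \<eta>" using l \<eta> by simp
    ultimately show ?thesis by (simp add: algebra_simps)
  qed
  obtain a where a: "a \<ge> 1"
    and gap: "(SUP z\<in>D4. \<Phi> u v (a / 2) 0 z) < (SUP z\<in>D4. \<Phi> u v a 0 z) + \<eta>"
    by (rule \<Phi>_sup_gap[where u = u and v = v and B = B, OF dense bounds(1,2) \<eta>])
  have a0: "a > 0" using a by simp
  have ne: "D4 \<noteq> {}" using dom_ne by (auto simp: D4_def)
  have bdd: "bdd_above (\<Phi> u v a' 0 ` D4)" if "a' \<ge> 0" for a'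
    using \<Phi>_le_bound[of u B v a' 0, OF bounds(1,2) that] by (intro bdd_aboveI2) simp
  have "(SUP z\<in>D4. \<Phi> u v a 0 z) - \<eta> / 2 < (SUP z\<in>D4. \<Phi> u v a 0 z)" using \<eta> by simp
  then obtain z1 where z1: "z1 \<in> D4" "(SUP z\<in>D4. \<Phi> u v a 0 z) - \<eta> / 2 < \<Phi> u v a 0 z1"
    using less_cSUP_iff[OF ne bdd[OF less_imp_le[OF a0]]] by blast
  obtain \<pi>1 \<rho>1 \<gamma>1 \<mu>1 where z1': "z1 = (\<pi>1, \<rho>1, \<gamma>1, \<mu>1)" by (cases z1)
  define P where "P = max 0 (e \<rho>1) + max 0 (e \<gamma>1)"
  have P: "P \<ge> 0" by (simp add: P_def)
  define K where "K = 2 * B / l + 19 * a * \<bar>\<kappa>\<bar> + 8 + 6 * a + 5 * a\<^sup>2"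
  define C where "C = 10 + 12 * a + 2 * a * K"
  have "K \<ge> 0" using a0 B l by (simp add: K_def)
  then have C: "C > 0" using a0 by (simp add: C_def add_pos_nonneg)
  define b where "b = min 1 (min (\<eta> / (2 * (P + 1))) (\<epsilon> / (4 * l * C)))"
  have b: "0 < b" "b \<le> 1" using \<eta> P \<epsilon> l C by (simp_all add: b_def)
  have bP: "b * P \<le> \<eta> / 2"
  proof -
    have "b \<le> \<eta> / (2 * (P + 1))"
      unfolding b_def by (rule min.coboundedI2) (rule min.cobounded1)
    then have "b * (2 * (P + 1)) \<le> \<eta>" using P by (simp add: pos_le_divide_eq)
    then show ?thesis using b by (simp add: algebra_simps)
  qed
  have bC: "l * (b * C) \<le> \<epsilon> / 4"
  proof -
    have "b \<le> \<epsilon> / (4 * l * C)"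
      unfolding b_def by (rule min.coboundedI2) (rule min.cobounded2)
    then have "b * (4 * l * C) \<le> \<epsilon>" using C l by (simp add: pos_le_divide_eq)
    then show ?thesis by (simp add: algebra_simps)
  qed
  obtain \<pi> \<rho> \<gamma> \<mu> where D: "\<rho> \<in> D" "\<gamma> \<in> D"
    and start: "\<Phi> u v a b z1 \<le> \<Phi> u v a b (\<pi>, \<rho>, \<gamma>, \<mu>)"
    and max: "\<And>\<pi>' \<rho>' \<gamma>' \<mu>'. \<rho>' \<in> D \<Longrightarrow> \<gamma>' \<in> D \<Longrightarrow>
      \<Phi> u v a b (\<pi>', \<rho>', \<gamma>', \<mu>') \<le> \<Phi> u v a b (\<pi>, \<rho>, \<gamma>, \<mu>)
      + b * (d\<^sub>T \<pi>' \<pi> + d\<^sub>T \<rho>' \<rho> + d\<^sub>T \<gamma>' \<gamma> + d\<^sub>T \<mu>' \<mu>)"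
    by (rule penalized_maximizer[where u = u and v = v and B = B,
          OF usc bounds(1) lsc_v bounds(2) less_imp_le[OF a0] b(1) z1(1)]) blast
  define x y z where "x = dist \<pi> \<rho>" and "y = dist \<rho> \<gamma>" and "z = dist \<gamma> \<mu>"
  have xyz: "x \<ge> 0" "y \<ge> 0" "z \<ge> 0" by (auto simp: x_def y_def z_def)
  let ?Q = "x\<^sup>2 + y\<^sup>2 + z\<^sup>2"
  have near: "(SUP z\<in>D4. \<Phi> u v a 0 z) - \<eta> \<le> u \<pi> - v \<mu> - a / 2 * ?Q"
  proof -
    have "\<Phi> u v a b z1 = \<Phi> u v a 0 z1 - b * P" by (simp add: z1' \<Phi>_def P_def)
    moreover have "0 \<le> b * (max 0 (e \<rho>) + max 0 (e \<gamma>))" using b by simp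
    ultimately show ?thesis using start z1(2) bP by (simp add: \<Phi>_def x_def y_def z_def)
  qed
  \<comment> \<open>Comparing with the supremum for \<open>a / 2\<close> leaves a quarter of \<open>a Q\<close> on the left.\<close>
  have "u \<pi> - v \<mu> - a / 4 * ?Q = \<Phi> u v (a / 2) 0 (\<pi>, \<rho>, \<gamma>, \<mu>)"
    by (simp add: \<Phi>_def x_def y_def z_def)
  also have "\<dots> \<le> (SUP z\<in>D4. \<Phi> u v (a / 2) 0 z)"
    using a0 D by (intro cSUP_upper bdd) (auto simp: D4_def)
  finally have Q: "a * ?Q \<le> 8 * \<eta>" using near gap by simp
  have Q1: "?Q \<le> 8 * \<eta>"
  proof -
    have "1 * ?Q \<le> a * ?Q" using a by (intro mult_right_mono) auto
    with Q show ?thesis by simp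
  qed
  have le3: "x \<le> 3" "y \<le> 3" "z \<le> 3"
  proof -
    have *: "w \<le> 3" if "w\<^sup>2 \<le> 8" for w :: real
      using power2_le_imp_le[of w 3] that by simp
    show "x \<le> 3" "y \<le> 3" "z \<le> 3"
      using Q1 \<eta>_le(1) zero_le_power2[of x] zero_le_power2[of y] zero_le_power2[of z]
      by (intro *; linarith)+
  qed
  have "dist \<pi> \<mu> < \<delta>"
  proof -
    have "dist \<pi> \<mu> \<le> x + y + z"
      using dist_triangle[of \<pi> \<mu> \<rho>] dist_triangle[of \<rho> \<mu> \<gamma>] by (simp add: x_def y_def z_def)
    then have "(dist \<pi> \<mu>)\<^sup>2 \<le> (x + y + z)\<^sup>2" by (intro power_mono) auto
    also have "\<dots> \<le> 3 * ?Q"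
      using zero_le_power2[of "x - y"] zero_le_power2[of "y - z"] zero_le_power2[of "x - z"]
      by (simp add: power2_eq_square algebra_simps)
    also have "\<dots> < \<delta>\<^sup>2" using Q1 \<eta>1 by simp
    finally show ?thesis using \<delta>(1) by (intro power2_less_imp_less[of _ \<delta>]) auto
  qed
  then have h1': "h1 \<pi> \<le> h1 \<mu> + \<epsilon> / 4" using \<delta>(2)[of \<pi> \<mu>] unfolding dist_real_def by linarith
  have max_\<pi>: "u y - a / 2 * (dist y \<rho>)\<^sup>2 - b * d\<^sub>T y \<pi> \<le> u \<pi> - a / 2 * (dist \<pi> \<rho>)\<^sup>2" for y
    using max[OF D, of y \<mu>] by (simp add: \<Phi>_def distrib_left)
  have max_\<mu>: "- v y - a / 2 * (dist y \<gamma>)\<^sup>2 - b * d\<^sub>T y \<mu> \<le> - v \<mu> - a / 2 * (dist \<mu> \<gamma>)\<^sup>2" for y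
    using max[OF D, of \<pi> y] by (simp add: \<Phi>_def distrib_left dist_commute)
  have max_\<rho>: "a / 2 * ((dist \<rho> \<pi>)\<^sup>2 + (dist \<rho> \<gamma>)\<^sup>2) + b * max 0 (e \<rho>)
      \<le> a / 2 * ((dist \<rho>' \<pi>)\<^sup>2 + (dist \<rho>' \<gamma>)\<^sup>2) + b * max 0 (e \<rho>') + b * d\<^sub>T \<rho>' \<rho>" if "\<rho>' \<in> D" for \<rho>'
    using max[OF that D(2), of \<pi> \<mu>] by (simp add: \<Phi>_def distrib_left dist_commute)
  have max_\<gamma>: "a / 2 * ((dist \<gamma> \<rho>)\<^sup>2 + (dist \<gamma> \<mu>)\<^sup>2) + b * max 0 (e \<gamma>)
      \<le> a / 2 * ((dist \<gamma>' \<rho>)\<^sup>2 + (dist \<gamma>' \<mu>)\<^sup>2) + b * max 0 (e \<gamma>') + b * d\<^sub>T \<gamma>' \<gamma>" if "\<gamma>' \<in> D" for \<gamma>'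
    using max[OF D(1) that, of \<pi> \<mu>] by (simp add: \<Phi>_def distrib_left dist_commute)
  note sub_test = subsolution_test[OF sub a0 b(1) l h1c D(1) max_\<pi>]
  note super_test = supersolution_test[OF super a0 b(1) l h2 D(2) max_\<mu>]
  note a_nn = less_imp_le[OF a0] less_imp_le[OF b(1)]
  have F1: "a * (e \<rho> - e \<pi>) \<le> a * (e \<gamma> - e \<rho>) - a * \<kappa> / 2 * (x\<^sup>2 + y\<^sup>2) + b"
    using flow_stationarity[OF D(1) sub_test(1) D(2) a_nn max_\<rho>]
    by (simp add: x_def y_def dist_commute)
  have F2: "a * (e \<gamma> - e \<mu>) \<le> a * (e \<rho> - e \<gamma>) - a * \<kappa> / 2 * (y\<^sup>2 + z\<^sup>2) + b"
  proof -
    have "a / 2 * ((dist \<gamma> \<mu>)\<^sup>2 + (dist \<gamma> \<rho>)\<^sup>2) + b * max 0 (e \<gamma>)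
      \<le> a / 2 * ((dist \<gamma>' \<mu>)\<^sup>2 + (dist \<gamma>' \<rho>)\<^sup>2) + b * max 0 (e \<gamma>') + b * d\<^sub>T \<gamma>' \<gamma>" if "\<gamma>' \<in> D" for \<gamma>'
      using max_\<gamma>[OF that] by (simp only: add.commute[of "(dist _ \<mu>)\<^sup>2"])
    from flow_stationarity[OF D(2) super_test(1) D(1) a_nn this] show ?thesis
      by (simp only: y_def z_def dist_commute[of \<gamma> \<rho>] add.commute[of "(dist \<gamma> \<mu>)\<^sup>2"])
  qed
  have G1: "a * x\<^sup>2 \<le> a * x * y + b * (x + max 0 (e \<pi> - e \<rho> + \<bar>\<kappa>\<bar> / 2 * x\<^sup>2))"
    using geodesic_stationarity[OF D(1) sub_test(1) D(2) a_nn geo max_\<rho>]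
    by (simp add: x_def y_def dist_commute)
  have G2: "a * y\<^sup>2 \<le> a * y * z + b * (y + max 0 (e \<rho> - e \<gamma> + \<bar>\<kappa>\<bar> / 2 * y\<^sup>2))"
    using geodesic_stationarity[OF D(2) D(1) super_test(1) a_nn geo max_\<gamma>]
    by (simp add: y_def z_def dist_commute)
  have sub': "u \<pi> - h1 \<pi> \<le> l * (a * (e \<rho> - e \<pi>) + (- a * (\<kappa> / 2) * x\<^sup>2 + 2 * b
      + 1 / 2 * a\<^sup>2 * x\<^sup>2 + a * (2 * b) * x + 1 / 2 * (2 * b)\<^sup>2))"
    using sub_test(2) unfolding x_def .
  have super': "- (v \<mu> - h2 \<mu>) \<le> l * (a * (e \<gamma> - e \<mu>) - (a * (\<kappa> / 2) * z\<^sup>2 - 2 * b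
      + 1 / 2 * a\<^sup>2 * z\<^sup>2 - a * (2 * b) * z - 1 / 2 * (2 * b)\<^sup>2))"
    using super_test(2) unfolding z_def dist_commute[of \<gamma> \<mu>] minus_diff_eq .
  have "- 2 * B \<le> u \<pi> - h1 \<pi>" using bounds(1)[of \<pi>] bounds(3)[of \<pi>] by linarith
  from hamiltonian_gap[OF a b l B xyz(1) le3(1) xyz(2) le3(2) xyz(3) le3(3) Q sub' super' this F1 F2 G1 G2]
  have "(u \<pi> - h1 \<pi>) - (v \<mu> - h2 \<mu>) \<le> l * (8 * \<bar>\<kappa>\<bar> * \<eta> + b * (10 + 12 * a + 2 * a * K))"
    unfolding K_def .
  then have "u \<pi> - v \<mu> \<le> h1 \<pi> - h2 \<mu> + \<epsilon> / 2"
    using \<eta>2 bC unfolding C_def distrib_left[of l] by linarith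
  moreover have "u p - v p \<le> u \<pi> - v \<mu> + \<eta>"
  proof -
    have "0 \<le> a / 2 * ?Q" using a0 by simp
    then show ?thesis
      using le_\<Phi>_sup[where u = u and v = v and B = B and \<pi> = p, OF dense bounds(1,2) less_imp_le[OF a0]] near by linarith
  qed
  ultimately show "u p - v p \<le> H + \<epsilon>" using h1' H[of \<mu>] \<eta>_le(2) by linarith
qed

theorem proposition5p13:
  fixes \<E> :: "'a::complete_space \<Rightarrow> ereal"
    and \<kappa> l :: real
    and A :: "('a, 'b::euclidean_space) chart set"
    and G :: "('a, 'b) chart \<Rightarrow> 'b \<Rightarrow> 'b \<Rightarrow> 'b \<Rightarrow> real"
    and S :: "real \<Rightarrow> 'a \<Rightarrow> 'a"
    and h1 h2 u v :: "'a \<Rightarrow> real"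
  assumes "\<forall>\<rho> \<pi> :: 'a. \<exists>\<zeta>. geodesic \<zeta> \<rho> \<pi>"
    and "\<forall>\<pi>. \<E> \<pi> \<noteq> -\<infinity>"
    and "lsc \<E>"
    and "eff_domain \<E> \<noteq> {}"
    and "closure (eff_domain \<E>) = UNIV"
    and "riemannian_manifold (eff_domain \<E>) A G"
    and "continuously_differentiable A (\<lambda>\<pi>. real_of_ereal (\<E> \<pi>))"
    and "convex_along_geodesics_in (eff_domain \<E>) \<kappa> \<E>"
    and "EVI_gradient_flow \<kappa> \<E> S"
    and "l > 0"
    and "bounded (range h1)" and "uniformly_continuous_on UNIV h1"
    and "bounded (range h2)" and "uniformly_continuous_on UNIV h2"
    and "viscosity_subsolution (H_dagger \<kappa> \<E> S) l h1 u"
    and "viscosity_supersolution (H_ddagger \<kappa> \<E> S) l h2 v"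
  shows "(SUP \<pi>. u \<pi> - v \<pi>) \<le> (SUP \<pi>. h1 \<pi> - h2 \<pi>)"
proof -
  interpret evi_flow \<E> \<kappa> S
    using assms(2,3,4,9) by unfold_locales auto
  have "bounded (range u)" "bounded (range v)"
    using assms(15,16) by (auto simp: viscosity_subsolution_def viscosity_supersolution_def)
  moreover have "\<exists>B. \<forall>x. \<bar>f x\<bar> \<le> B" if "bounded (range f)" for f :: "'a \<Rightarrow> real"
    using that by (auto simp: bounded_iff)
  ultimately have "\<exists>B. \<forall>x. \<bar>u x\<bar> \<le> B" "\<exists>B. \<forall>x. \<bar>v x\<bar> \<le> B"
    "\<exists>B. \<forall>x. \<bar>h1 x\<bar> \<le> B" "\<exists>B. \<forall>x. \<bar>h2 x\<bar> \<le> B"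
    using assms(11,13) by blast+
  then obtain B1 B2 B3 B4 where
    bnd: "\<And>x. \<bar>u x\<bar> \<le> B1" "\<And>x. \<bar>v x\<bar> \<le> B2" "\<And>x. \<bar>h1 x\<bar> \<le> B3" "\<And>x. \<bar>h2 x\<bar> \<le> B4"
    by blast
  define B where "B = max B1 (max B2 B3)"
  have B: "\<bar>u x\<bar> \<le> B" "\<bar>v x\<bar> \<le> B" "\<bar>h1 x\<bar> \<le> B" for x
    using bnd(1)[of x] bnd(2)[of x] bnd(3)[of x] by (auto simp: B_def)
  have "h1 x - h2 x \<le> B3 + B4" for x using bnd(3)[of x] bnd(4)[of x] by linarith
  then have "bdd_above (range (\<lambda>x. h1 x - h2 x))" by (rule bdd_aboveI2)
  from cSUP_upper[OF UNIV_I this] have H: "h1 x - h2 x \<le> (SUP x. h1 x - h2 x)" for x .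
  show ?thesis
  proof (rule cSUP_least)
    fix p
    show "u p - v p \<le> (SUP x. h1 x - h2 x)"
      by (rule comparison[where u = u and v = v and ?h1.0 = h1 and ?h2.0 = h2 and B = B,
            OF assms(1)[rule_format] assms(5,10,12)
              uniformly_continuous_imp_continuous[OF assms(14)] B assms(15,16) H])
  qed simp
qed

end
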